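(* Assume that the equation $x'=A_3(t)x^{n_3}+A_2(t)x^{n_2}+A_1(t)x^{n_1}$ satisfies (ND) and has at least two nonconstant rational solutions. Let $r:=\max\Gamma_{\mathrm{sol}}$ be the maximal realized denominator degree, and let $\mathcal{S}$ be the total number of nonconstant rational solutions. Then the following bounds hold, according to which of the alternatives (C1)–(C3) below holds at $r$: (a) If (C1) holds, then necessarily $T_r=\{3,2,\partial\}$ and $\mathcal{S}\le n_3-1$. (b) If (C2) holds and $T_r=\{2,1\}$, then $\mathcal{S}\le n_3$. (c) If (C2) holds and $T_r=\{3,2,1\}$, then $\mathcal{S}\le n_3-n_1$. (d) If (C3) holds and $T_r=\{2,1,\partial\}$, then $\mathcal{S}\le(n_2-1)+2(n_3-1)$. (e) If (C3) holds and $T_r=\{3,1,\partial\}$, then $\mathcal{S}\le n_3-1$. (f) If (C3) holds and $T_r=\{3,2,1,\partial\}$, then $\mathcal{S}\le n_3-1$. Here (C1): $a_1<(n_1-1)r-1$ and $a_2=(n_2-1)r-1$; (C2): $a_1>(n_1-1)r-1$ and $a_2=a_1+(n_2-n_1)r$; (C3): $a_1=(n_1-1)r-1$ and $a_2\le(n_2-1)r-1$.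
   Context: Setting. $\Bbbk\in\{\mathbb{R},\mathbb{C}\}$; $n_1,n_2,n_3$ are natural numbers with $1<n_1<n_2<n_3$; $A_1,A_2,A_3\in\Bbbk[t]$ are nonzero, $a_i:=\deg A_i$, and $\alpha_i\in\Bbbk^\times$ is the leading coefficient of $A_i$. Every nonconstant rational solution of the equation has the form $x=1/p(t)$ with $p\in\Bbbk[t]$, $\deg p\ge1$; $\Gamma_{\mathrm{sol}}$ denotes the set of all $\deg p$ such that $1/p$ is a nonconstant rational solution of the equation. Tie sets and edge polynomials. The symbol $\partial$ is an extra index (encoding the derivative term), with $a_\partial=-1$, $n_\partial=1$. For $r\in\mathbb{N}_{>0}$ set $\Phi_i(r)=n_ir-a_i$ ($i=1,2,3$), $\Phi_\partial(r)=r+1$, $O_r=\min\{\Phi_\ell(r):\ell\in\{3,2,1,\partial\}\}$ and $T_r=\{\ell\in\{3,2,1,\partial\}:\Phi_\ell(r)=O_r\}$. The value $r$ is edge-admissible if $|T_r|\ge2$; then its edge polynomial is $P_r(C)=\sum_{\ell\in T_r\cap\{3,2,1\}}\alpha_\ell C^{n_\ell}+\mathbf{1}_{\{\partial\in T_r\}}\,rC$. Candidate degrees. $r_{32}=\frac{a_3-a_2}{n_3-n_2}$, $r_{31}=\frac{a_3-a_1}{n_3-n_1}$, $r_{21}=\frac{a_2-a_1}{n_2-n_1}$, $r_{i\partial}=\frac{a_i+1}{n_i-1}$ ($i=1,2,3$), $r_0=\frac{a_3}{n_3-n_2}$, and $\Gamma=\{r_{32},r_{31},r_{21},r_{3\partial},r_{2\partial},r_{1\partial}\}\cap\mathbb{N}\cap(0,r_0]$.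 Hypothesis (ND). For every edge-admissible $r\in\Gamma$, with $e_r$ the multiplicity of $0$ as a root of $P_r$ and $\widetilde P_r(C)=P_r(C)/C^{e_r}$: (ND1) $\operatorname{Res}_C(\widetilde P_r(C),\widetilde P_r'(C))\ne0$, i.e. $\widetilde P_r$ has only simple roots; (ND2) if $\partial\in T_r$, then $P_r'(C)\notin\mathbb{Z}_{<0}$ for every nonzero root $C\in\Bbbk$ of $P_r$; (ND3) (a) if $\Bbbk=\mathbb{C}$: $\operatorname{Res}_C(\widetilde P_r(C),\widetilde P_r(C/\zeta))\ne0$ for every $\zeta\in(\mu_{n_3-n_2}\cup\mu_{n_3-n_1}\cup\mu_{n_3-1})\setminus\{1\}$, where $\mu_m=\{\zeta\in\mathbb{C}^\times:\zeta^m=1\}$; (b) if $\Bbbk=\mathbb{R}$: $\operatorname{Res}_C(\widetilde P_r(C),\widetilde P_r(-C))\ne0$ whenever at least one of $n_3-n_2$, $n_3-n_1$, $n_3-1$ is even (no condition if all three are odd). *)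

theory Defs
  imports
    Complex_Main
    "Subresultants.Resultant_Prelim"
    "HOL-Computational_Algebra.Computational_Algebra"
begin

text \<open>
  The equation is \<open>x' = A\<^sub>3 x^n\<^sub>3 + A\<^sub>2 x^n\<^sub>2 + A\<^sub>1 x^n\<^sub>1\<close>. The exponents and the coefficients are families
  \<open>n :: nat \<Rightarrow> nat\<close> and \<open>A :: nat \<Rightarrow> 'a poly\<close> of which only the values at 1, 2, 3 are used.
  The field of rational functions is \<open>'a poly fract\<close>.
\<close>

section \<open>Rational solutions\<close>

text \<open>The quotient rule \<open>(p/q)' = (p' q - p q') / q^2\<close>.\<close>

definition fract_deriv :: "'a::field poly fract \<Rightarrow> 'a poly fract" where
  "fract_deriv x =
    (THE y. \<exists>p q. q \<noteq> 0 \<and> x = Fract p q \<and> y = Fract (pderiv p * q - p * pderiv q) (q * q))"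

lemma fract_deriv_well_defined:
  fixes a b c d :: "'a::field poly"
  assumes nz: "b \<noteq> 0" "d \<noteq> 0" and same: "Fract a b = Fract c d"
  shows "Fract (pderiv a * b - a * pderiv b) (b * b) = Fract (pderiv c * d - c * pderiv d) (d * d)"
proof -
  have eq: "a * d = c * b"
    using nz same by (simp add: eq_fract)
  have "pderiv (a * d) = pderiv (c * b)"
    using eq by simp
  then have eq': "pderiv a * d = c * pderiv b + b * pderiv c - a * pderiv d"
    by (simp add: pderiv_mult algebra_simps)
  have "(pderiv a * b - a * pderiv b) * (d * d) = (pderiv a * d) * (b * d) - (a * d) * (pderiv b * d)"
    by (simp add: algebra_simps)
  also have "\<dots> = (c * pderiv b + b * pderiv c - a * pderiv d) * (b * d) - (c * b) * (pderiv b * d)"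
    unfolding eq eq' ..
  also have "\<dots> = pderiv c * d * (b * b) - (a * d) * (b * pderiv d)"
    by (simp add: algebra_simps)
  also have "\<dots> = (pderiv c * d - c * pderiv d) * (b * b)"
    unfolding eq by (simp add: algebra_simps)
  finally show ?thesis
    using nz by (simp add: eq_fract)
qed

lemma fract_deriv_Fract:
  assumes "q \<noteq> 0"
  shows "fract_deriv (Fract p q) = Fract (pderiv p * q - p * pderiv q) (q * q)"
  unfolding fract_deriv_def
proof (rule the_equality)
  show "\<exists>a b. b \<noteq> 0 \<and> Fract p q = Fract a b \<and>
      Fract (pderiv p * q - p * pderiv q) (q * q) = Fract (pderiv a * b - a * pderiv b) (b * b)"
    using assms by (intro exI conjI) (rule refl | assumption)+
next
  fix y
  assume "\<exists>a b. b \<noteq> 0 \<and> Fract p q = Fract a b \<and> y = Fract (pderiv a * b - a * pderiv b) (b * b)"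
  then obtain a b where "b \<noteq> 0" "Fract p q = Fract a b"
    and y: "y = Fract (pderiv a * b - a * pderiv b) (b * b)"
    by (elim exE conjE)
  then show "y = Fract (pderiv p * q - p * pderiv q) (q * q)"
    unfolding y by (intro fract_deriv_well_defined[symmetric] assms)
qed

definition nonconst_rat_sols :: "(nat \<Rightarrow> nat) \<Rightarrow> (nat \<Rightarrow> 'a::field_char_0 poly) \<Rightarrow> 'a poly fract set" where
  "nonconst_rat_sols n A =
    {x. fract_deriv x = to_fract (A 3) * x ^ n 3 + to_fract (A 2) * x ^ n 2 + to_fract (A 1) * x ^ n 1
        \<and> (\<nexists>c. x = to_fract [:c:])}"

definition Gamma_sol :: "(nat \<Rightarrow> nat) \<Rightarrow> (nat \<Rightarrow> 'a::field_char_0 poly) \<Rightarrow> nat set" where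
  "Gamma_sol n A = {degree p | p. degree p \<ge> 1 \<and> Fract 1 p \<in> nonconst_rat_sols n A}"

section \<open>Tie sets and edge polynomials\<close>

text \<open>The extra index for the derivative term is encoded as 0.\<close>

abbreviation (input) deriv_idx :: nat  ("\<partial>") where "\<partial> \<equiv> 0"

definition Phi :: "(nat \<Rightarrow> nat) \<Rightarrow> (nat \<Rightarrow> 'a::field_char_0 poly) \<Rightarrow> nat \<Rightarrow> nat \<Rightarrow> int" where
  "Phi n A l r = (if l = \<partial> then int r + 1 else int (n l) * int r - int (degree (A l)))"

definition tie_set :: "(nat \<Rightarrow> nat) \<Rightarrow> (nat \<Rightarrow> 'a::field_char_0 poly) \<Rightarrow> nat \<Rightarrow> nat set" where
  "tie_set n A r =
    {l \<in> {3, 2, 1, \<partial>}. Phi n A l r = Min ((\<lambda>k. Phi n A k r) ` {3, 2, 1, \<partial>})}"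

definition edge_admissible :: "(nat \<Rightarrow> nat) \<Rightarrow> (nat \<Rightarrow> 'a::field_char_0 poly) \<Rightarrow> nat \<Rightarrow> bool" where
  "edge_admissible n A r \<longleftrightarrow> r > 0 \<and> card (tie_set n A r) \<ge> 2"

definition edge_poly :: "(nat \<Rightarrow> nat) \<Rightarrow> (nat \<Rightarrow> 'a::field_char_0 poly) \<Rightarrow> nat \<Rightarrow> 'a poly" where
  "edge_poly n A r =
    (\<Sum>l \<in> tie_set n A r \<inter> {3, 2, 1}. monom (lead_coeff (A l)) (n l))
      + (if \<partial> \<in> tie_set n A r then monom (of_nat r) 1 else 0)"

definition red_edge_poly :: "(nat \<Rightarrow> nat) \<Rightarrow> (nat \<Rightarrow> 'a::field_char_0 poly) \<Rightarrow> nat \<Rightarrow> 'a poly" where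
  "red_edge_poly n A r = edge_poly n A r div [:0, 1:] ^ Polynomial.order 0 (edge_poly n A r)"

section \<open>Candidate degrees\<close>

definition r_pair :: "(nat \<Rightarrow> nat) \<Rightarrow> (nat \<Rightarrow> 'a::field_char_0 poly) \<Rightarrow> nat \<Rightarrow> nat \<Rightarrow> real" where
  "r_pair n A i j =
    (real (degree (A i)) - real (degree (A j))) / (real (n i) - real (n j))"

definition r_deriv :: "(nat \<Rightarrow> nat) \<Rightarrow> (nat \<Rightarrow> 'a::field_char_0 poly) \<Rightarrow> nat \<Rightarrow> real" where
  "r_deriv n A i = (real (degree (A i)) + 1) / (real (n i) - 1)"

definition r_zero :: "(nat \<Rightarrow> nat) \<Rightarrow> (nat \<Rightarrow> 'a::field_char_0 poly) \<Rightarrow> real" where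
  "r_zero n A = real (degree (A 3)) / (real (n 3) - real (n 2))"

definition Gamma_cand :: "(nat \<Rightarrow> nat) \<Rightarrow> (nat \<Rightarrow> 'a::field_char_0 poly) \<Rightarrow> nat set" where
  "Gamma_cand n A =
    {r. real r \<in> {r_pair n A 3 2, r_pair n A 3 1, r_pair n A 2 1,
                   r_deriv n A 3, r_deriv n A 2, r_deriv n A 1}
        \<and> 0 < real r \<and> real r \<le> r_zero n A}"

section \<open>The nondegeneracy hypothesis\<close>

definition ND1 :: "(nat \<Rightarrow> nat) \<Rightarrow> (nat \<Rightarrow> 'a::field_char_0 poly) \<Rightarrow> nat \<Rightarrow> bool" where
  "ND1 n A r \<longleftrightarrow> resultant (red_edge_poly n A r) (pderiv (red_edge_poly n A r)) \<noteq> 0"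

definition ND2 :: "(nat \<Rightarrow> nat) \<Rightarrow> (nat \<Rightarrow> 'a::field_char_0 poly) \<Rightarrow> nat \<Rightarrow> bool" where
  "ND2 n A r \<longleftrightarrow>
    (\<partial> \<in> tie_set n A r \<longrightarrow>
      (\<forall>C. C \<noteq> 0 \<and> poly (edge_poly n A r) C = 0 \<longrightarrow>
        poly (pderiv (edge_poly n A r)) C \<notin> of_int ` {z. z < 0}))"

definition roots_of_unity :: "nat \<Rightarrow> complex set" where
  "roots_of_unity m = {\<zeta>. \<zeta> \<noteq> 0 \<and> \<zeta> ^ m = 1}"

definition ND3_complex :: "(nat \<Rightarrow> nat) \<Rightarrow> (nat \<Rightarrow> complex poly) \<Rightarrow> nat \<Rightarrow> bool" where
  "ND3_complex n A r \<longleftrightarrow>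
    (\<forall>\<zeta> \<in> (roots_of_unity (n 3 - n 2) \<union> roots_of_unity (n 3 - n 1) \<union> roots_of_unity (n 3 - 1)) - {1}.
      resultant (red_edge_poly n A r) (pcompose (red_edge_poly n A r) [:0, 1 / \<zeta>:]) \<noteq> 0)"

definition ND3_real :: "(nat \<Rightarrow> nat) \<Rightarrow> (nat \<Rightarrow> real poly) \<Rightarrow> nat \<Rightarrow> bool" where
  "ND3_real n A r \<longleftrightarrow>
    (even (n 3 - n 2) \<or> even (n 3 - n 1) \<or> even (n 3 - 1) \<longrightarrow>
      resultant (red_edge_poly n A r) (pcompose (red_edge_poly n A r) [:0, -1:]) \<noteq> 0)"

definition ND_complex :: "(nat \<Rightarrow> nat) \<Rightarrow> (nat \<Rightarrow> complex poly) \<Rightarrow> bool" where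
  "ND_complex n A \<longleftrightarrow>
    (\<forall>r \<in> Gamma_cand n A. edge_admissible n A r \<longrightarrow> ND1 n A r \<and> ND2 n A r \<and> ND3_complex n A r)"

definition ND_real :: "(nat \<Rightarrow> nat) \<Rightarrow> (nat \<Rightarrow> real poly) \<Rightarrow> bool" where
  "ND_real n A \<longleftrightarrow>
    (\<forall>r \<in> Gamma_cand n A. edge_admissible n A r \<longrightarrow> ND1 n A r \<and> ND2 n A r \<and> ND3_real n A r)"

section \<open>The alternatives at a given degree\<close>

definition C1 :: "(nat \<Rightarrow> nat) \<Rightarrow> (nat \<Rightarrow> 'a::field_char_0 poly) \<Rightarrow> nat \<Rightarrow> bool" where
  "C1 n A r \<longleftrightarrow>
    int (degree (A 1)) < (int (n 1) - 1) * int r - 1 \<and>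
    int (degree (A 2)) = (int (n 2) - 1) * int r - 1"

definition C2 :: "(nat \<Rightarrow> nat) \<Rightarrow> (nat \<Rightarrow> 'a::field_char_0 poly) \<Rightarrow> nat \<Rightarrow> bool" where
  "C2 n A r \<longleftrightarrow>
    int (degree (A 1)) > (int (n 1) - 1) * int r - 1 \<and>
    int (degree (A 2)) = int (degree (A 1)) + (int (n 2) - int (n 1)) * int r"

definition C3 :: "(nat \<Rightarrow> nat) \<Rightarrow> (nat \<Rightarrow> 'a::field_char_0 poly) \<Rightarrow> nat \<Rightarrow> bool" where
  "C3 n A r \<longleftrightarrow>
    int (degree (A 1)) = (int (n 1) - 1) * int r - 1 \<and>
    int (degree (A 2)) \<le> (int (n 2) - 1) * int r - 1"

end

theory Submission
  imports
    Defs
    "Subresultants.Subresultant_Gcd"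
    "HOL-Computational_Algebra.Field_as_Ring"
begin

text \<open>
  A nonconstant rational solution is \<open>1/p\<close> with
  \<open>A\<^sub>3 + A\<^sub>2 p^(n\<^sub>3-n\<^sub>2) + A\<^sub>1 p^(n\<^sub>3-n\<^sub>1) + p' p^(n\<^sub>3-2) = 0\<close>. The top coefficient of this equation says
  that the inverse \<open>C\<close> of the leading coefficient of \<open>p\<close> is a root of the edge polynomial of
  \<open>r = degree p\<close>, and by (ND1) and (ND2) the pair \<open>(r, C)\<close> determines \<open>p\<close>. So there are at most as many
  solutions of degree \<open>r\<close> as the difference of the extreme exponents in the tie set. When the degree
  decreases, terms of smaller exponent than a tied one drop out of the tie set: below a degree at
  which 3 is tied there are no solutions, and below a degree at which 2 is tied the only possible
  tie set is \<open>{3, 2}\<close>, which occurs at a single degree.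
\<close>

declare One_nat_def [simp del]

section \<open>Polynomials\<close>

text \<open>In the convolution at \<open>a + b\<close> only the index \<open>i = a\<close> survives.
  The degrees are merely bounded, so that the tied and untied terms of an equation can be read off
  at one common degree.\<close>

lemma coeff_mult_at_degree_bounds:
  assumes "degree f \<le> a" "degree g \<le> b" "a + b \<le> k"
  shows "coeff (f * g) k = (if a + b = k then coeff f a * coeff g b else 0)"
proof (cases "a + b = k")
  case True
  have "coeff f i * coeff g (k - i) = 0" if "i \<le> k" "i \<noteq> a" for i
  proof (cases "i < a")
    case True
    then show ?thesis
      using assms \<open>a + b = k\<close> by (simp add: coeff_eq_0)
  next
    case False
    then show ?thesis
      using that assms by (simp add: coeff_eq_0)
  qed
  then have "(\<Sum>i\<le>k. coeff f i * coeff g (k - i)) = (\<Sum>i\<in>{a}. coeff f i * coeff g (k - i))"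
    using True by (intro sum.mono_neutral_right) auto
  then show ?thesis
    using True by (auto simp: coeff_mult)
next
  case False
  then have "degree (f * g) < k"
    using degree_mult_le[of f g] assms by linarith
  then show ?thesis
    using False by (simp add: coeff_eq_0)
qed

lemma degree_power_le_mult: "degree p \<le> r \<Longrightarrow> degree (p ^ k) \<le> k * r"
  by (metis degree_power_le mult.commute mult_le_mono1 order_trans)

lemma coeff_power_at_degree_bound:
  assumes "degree p \<le> r"
  shows "coeff (p ^ k) (k * r) = coeff p r ^ k"
proof (induction k)
  case (Suc k)
  show ?case
    using coeff_mult_at_degree_bounds[OF assms degree_power_le_mult[OF assms, of k], of "Suc k * r"]
      Suc by simp
qed simp

text \<open>Both claims come from the factorization of \<open>p ^ k - q ^ k\<close> into
  \<open>p - q\<close> and a sum of products \<open>q ^ (k - Suc i) * p ^ i\<close>, each of degree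
  at most \<open>(k - 1) * r\<close>.\<close>

lemma power_diff_at_degree_bounds:
  fixes p q :: "'a::comm_ring_1 poly"
  assumes "degree p \<le> r" "degree q \<le> r" "degree (p - q) \<le> s"
  shows "degree (p ^ k - q ^ k) \<le> s + (k - 1) * r"
    and "coeff (p ^ k - q ^ k) (s + (k - 1) * r) =
      coeff (p - q) s * (\<Sum>i<k. coeff q r ^ (k - Suc i) * coeff p r ^ i)"
proof -
  define W where "W = (\<Sum>i<k. q ^ (k - Suc i) * p ^ i)"
  have pq: "p ^ k - q ^ k = (p - q) * W"
    unfolding W_def by (rule power_diff_sumr2)
  have exps: "(k - Suc i) * r + i * r = (k - 1) * r" if "i < k" for i
  proof -
    have "k - Suc i + i = k - 1"
      using that by simp
    then show ?thesis
      by (simp flip: add_mult_distrib)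
  qed
  have degW: "degree W \<le> (k - 1) * r"
    unfolding W_def
  proof (rule degree_sum_le)
    fix i assume "i \<in> {..<k}"
    then show "degree (q ^ (k - Suc i) * p ^ i) \<le> (k - 1) * r"
      using degree_mult_le[of "q ^ (k - Suc i)" "p ^ i"] degree_power_le_mult[OF assms(1), of i]
        degree_power_le_mult[OF assms(2), of "k - Suc i"] exps[of i] by simp
  qed simp
  have coeffW: "coeff W ((k - 1) * r) = (\<Sum>i<k. coeff q r ^ (k - Suc i) * coeff p r ^ i)"
    unfolding W_def coeff_sum
  proof (rule sum.cong)
    fix i assume "i \<in> {..<k}"
    then show "coeff (q ^ (k - Suc i) * p ^ i) ((k - 1) * r) = coeff q r ^ (k - Suc i) * coeff p r ^ i"
      using coeff_mult_at_degree_bounds[OF degree_power_le_mult[OF assms(2), of "k - Suc i"]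
          degree_power_le_mult[OF assms(1), of i], of "(k - 1) * r"] exps[of i]
      by (simp add: coeff_power_at_degree_bound assms)
  qed simp
  show "degree (p ^ k - q ^ k) \<le> s + (k - 1) * r"
    unfolding pq using degree_mult_le[of "p - q" W] assms(3) degW by linarith
  show "coeff (p ^ k - q ^ k) (s + (k - 1) * r) =
      coeff (p - q) s * (\<Sum>i<k. coeff q r ^ (k - Suc i) * coeff p r ^ i)"
    unfolding pq using coeff_mult_at_degree_bounds[OF assms(3) degW order_refl] coeffW by simp
qed

text \<open>When \<open>p\<close> and \<open>q\<close> share the coefficient \<open>c\<close> at
  \<open>r\<close>, all \<open>k\<close> summands of the cofactor contribute
  \<open>c ^ (k - 1)\<close>, as in the derivative of a power.\<close>

lemma coeff_power_diff:
  fixes p q :: "'a::comm_ring_1 poly"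
  assumes "degree p \<le> r" "degree q \<le> r" "degree (p - q) \<le> s" "coeff p r = c" "coeff q r = c"
  shows "coeff (p ^ k - q ^ k) (s + (k - 1) * r) = of_nat k * c ^ (k - 1) * coeff (p - q) s"
proof -
  have "(\<Sum>i<k. c ^ (k - Suc i) * c ^ i) = (\<Sum>i<k. c ^ (k - 1))"
    by (intro sum.cong) (auto simp: One_nat_def simp flip: power_add)
  then show ?thesis
    using power_diff_at_degree_bounds(2)[OF assms(1-3), of k] assms(4,5) by (simp add: algebra_simps)
qed

section \<open>Nonzero roots and resultants\<close>

text \<open>The power \<open>X ^ m\<close> divides \<open>p\<close>, and the nonzero roots of
  \<open>p\<close> are roots of the cofactor, whose degree is at most \<open>M - m\<close>.\<close>

lemma card_nonzero_roots_le:
  fixes p :: "'a::idom poly"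
  assumes "p \<noteq> 0" "degree p \<le> M" "\<And>k. k < m \<Longrightarrow> coeff p k = 0"
  shows "finite {x. x \<noteq> 0 \<and> poly p x = 0}" and "card {x. x \<noteq> 0 \<and> poly p x = 0} \<le> M - m"
proof -
  have "monom 1 m dvd p"
    using assms(3) by (simp add: monom_1_dvd_iff')
  then obtain q where q: "p = monom 1 m * q"
    by (elim dvdE)
  have "q \<noteq> 0"
    using assms(1) q by auto
  then have "degree p = m + degree q"
    by (simp add: q degree_mult_eq degree_monom_eq)
  have roots: "{x. x \<noteq> 0 \<and> poly p x = 0} \<subseteq> {x. poly q x = 0}"
    by (auto simp: q poly_monom)
  have fin: "finite {x. poly q x = 0}"
    using \<open>q \<noteq> 0\<close> by (rule poly_roots_finite)
  show "finite {x. x \<noteq> 0 \<and> poly p x = 0}"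
    using roots fin by (rule finite_subset)
  show "card {x. x \<noteq> 0 \<and> poly p x = 0} \<le> M - m"
    using card_mono[OF fin roots] card_poly_roots_bound[OF \<open>q \<noteq> 0\<close>] \<open>degree p = m + degree q\<close> assms(2)
    by linarith
qed

text \<open>The linear factor of a common root divides the gcd, and the resultant vanishes when the
  gcd is nonconstant.\<close>

lemma resultant_eq_0_common_root:
  fixes f g :: "'a::{field_char_0, field_gcd} poly"
  assumes "f \<noteq> 0" "poly f x = 0" "poly g x = 0"
  shows "resultant f g = 0"
proof -
  have "[:- x, 1:] dvd gcd f g"
    using assms by (simp add: poly_eq_0_iff_dvd)
  moreover have "gcd f g \<noteq> 0"
    using assms(1) by simp
  ultimately have "degree [:- x, 1:] \<le> degree (gcd f g)"
    by (rule dvd_imp_degree_le)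
  then show ?thesis
    by (simp add: resultant_0_gcd)
qed

text \<open>Translates powers of a leading coefficient \<open>c\<close> in the equation for the
  denominator into powers of its inverse, the variable of the edge polynomial.\<close>

lemma power_diff_mult_inverse:
  fixes c :: "'a::field"
  assumes "c \<noteq> 0" "k \<le> m"
  shows "c ^ (m - k) * inverse c ^ m = inverse c ^ k"
  using assms by (simp add: power_diff power_inverse field_simps)

lemma to_fract_power: "to_fract (x ^ k) = to_fract x ^ k"
  by (induction k) simp_all

section \<open>Rational solutions\<close>

text \<open>The equation for \<open>x = 1/p\<close> multiplied by \<open>p ^ n 3\<close>, with all
  terms on one side; the last term comes from \<open>x' = - p'/p^2\<close>.\<close>

definition den_sols :: "(nat \<Rightarrow> nat) \<Rightarrow> (nat \<Rightarrow> 'a::field_char_0 poly) \<Rightarrow> 'a poly set" where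
  "den_sols n A = {p. degree p \<ge> 1 \<and>
    A 3 + A 2 * p ^ (n 3 - n 2) + A 1 * p ^ (n 3 - n 1) + pderiv p * p ^ (n 3 - 2) = 0}"

text \<open>Real and complex coefficients are treated together; \<open>field_gcd\<close> supplies
  gcds of polynomials and with them reduced fractions.\<close>

locale power_ode =
  fixes n :: "nat \<Rightarrow> nat" and A :: "nat \<Rightarrow> 'a::{field_char_0, field_gcd} poly"
  assumes n1: "1 < n 1" and n12: "n 1 < n 2" and n23: "n 2 < n 3"
    and A1: "A 1 \<noteq> 0" and A2: "A 2 \<noteq> 0" and A3: "A 3 \<noteq> 0"
begin

text \<open>Multiplication by \<open>v ^ n 3\<close> clears all denominators; the derivative has
  denominator \<open>v^2\<close>, which leaves the factor \<open>v ^ (n 3 - 2)\<close>.\<close>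

lemma fract_sol_iff:
  assumes "v \<noteq> 0"
  shows "fract_deriv (Fract u v) = to_fract (A 3) * Fract u v ^ n 3 + to_fract (A 2) * Fract u v ^ n 2
      + to_fract (A 1) * Fract u v ^ n 1 \<longleftrightarrow>
    (pderiv u * v - u * pderiv v) * v ^ (n 3 - 2) =
      A 3 * u ^ n 3 + A 2 * (u ^ n 2 * v ^ (n 3 - n 2)) + A 1 * (u ^ n 1 * v ^ (n 3 - n 1))"
    (is "?L = ?R \<longleftrightarrow> ?l = ?r")
proof -
  define V where "V = to_fract v"
  have V: "V \<noteq> 0"
    using assms by (simp add: V_def)
  have pow: "Fract u v ^ k * V ^ n 3 = to_fract (u ^ k * v ^ (n 3 - k))" if "k \<le> n 3" for k
  proof -
    have "V ^ n 3 = V ^ k * V ^ (n 3 - k)"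
      using that by (simp flip: power_add)
    then show ?thesis
      using V by (simp add: Fract_conv_to_fract to_fract_power power_divide flip: V_def)
  qed
  have "n 3 = 2 + (n 3 - 2)"
    using n1 n12 n23 by simp
  then have "V ^ n 3 = V ^ 2 * V ^ (n 3 - 2)"
    by (metis power_add)
  then have V_pow: "V ^ n 3 = V * V * V ^ (n 3 - 2)"
    by (simp add: power2_eq_square)
  have deriv: "fract_deriv (Fract u v) * (V * V) = to_fract (pderiv u * v - u * pderiv v)"
    unfolding fract_deriv_Fract[OF assms] unfolding Fract_conv_to_fract
    using V by (simp add: V_def)
  have "?L * V ^ n 3 = fract_deriv (Fract u v) * (V * V) * V ^ (n 3 - 2)"
    by (simp only: V_pow mult.assoc)
  also have "\<dots> = to_fract ?l"
    unfolding deriv by (simp only: V_def to_fract_mult to_fract_power)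
  finally have "?L * V ^ n 3 = to_fract ?l" .
  moreover have "?R * V ^ n 3 = to_fract ?r"
    using pow[of "n 3"] pow[of "n 2"] pow[of "n 1"] n12 n23
    unfolding distrib_right mult.assoc to_fract_add to_fract_mult by simp
  moreover have "?L = ?R \<longleftrightarrow> ?L * V ^ n 3 = ?R * V ^ n 3"
    using V by simp
  ultimately show ?thesis
    by (simp only: to_fract_eq_iff)
qed

lemma Fract_1_sol_iff:
  assumes "p \<noteq> 0"
  shows "fract_deriv (Fract 1 p) = to_fract (A 3) * Fract 1 p ^ n 3 + to_fract (A 2) * Fract 1 p ^ n 2
      + to_fract (A 1) * Fract 1 p ^ n 1 \<longleftrightarrow>
    A 3 + A 2 * p ^ (n 3 - n 2) + A 1 * p ^ (n 3 - n 1) + pderiv p * p ^ (n 3 - 2) = 0"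
proof -
  have "- a = b \<longleftrightarrow> b + a = 0" for a b :: "'a poly"
    by (metis add_eq_0_iff add.commute)
  then show ?thesis
    unfolding fract_sol_iff[OF assms] by simp
qed

text \<open>Let \<open>u/v\<close> be a solution in lowest terms. All exponents are at least 2, so
  \<open>u^2\<close> divides \<open>u' v - u v'\<close>, hence \<open>u\<close> divides
  \<open>u'\<close>. In characteristic zero \<open>u\<close> is then a constant, which is absorbed
  into the denominator.\<close>

lemma nonconst_rat_sols_eq: "nonconst_rat_sols n A = Fract 1 ` den_sols n A"
proof (intro Set.set_eqI iffI)
  fix x assume x: "x \<in> nonconst_rat_sols n A"
  define u where "u = fst (quot_of_fract x)"
  define v where "v = snd (quot_of_fract x)"
  have x_eq: "x = Fract u v" and "v \<noteq> 0" and "coprime u v"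
    by (simp_all add: u_def v_def coprime_quot_of_fract)
  have eq: "(pderiv u * v - u * pderiv v) * v ^ (n 3 - 2) =
      A 3 * u ^ n 3 + A 2 * (u ^ n 2 * v ^ (n 3 - n 2)) + A 1 * (u ^ n 1 * v ^ (n 3 - n 1))"
    using x fract_sol_iff[OF \<open>v \<noteq> 0\<close>, of u] by (simp add: nonconst_rat_sols_def x_eq)
  have "u dvd pderiv u"
  proof -
    have "u ^ 2 dvd u ^ n i" if "i \<in> {1, 2, 3}" for i
      using that n1 n12 n23 by (intro le_imp_power_dvd) auto
    then have "u ^ 2 dvd (pderiv u * v - u * pderiv v) * v ^ (n 3 - 2)"
      unfolding eq by (intro dvd_add dvd_mult dvd_mult2) simp_all
    then have "u ^ 2 dvd pderiv u * v - u * pderiv v"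
      using \<open>coprime u v\<close> by (simp add: coprime_dvd_mult_left_iff)
    then have "u dvd pderiv u * v - u * pderiv v"
      by (rule dvd_trans[rotated]) simp
    then have "u dvd pderiv u * v"
      by (simp add: dvd_diff_left_iff)
    then show ?thesis
      using \<open>coprime u v\<close> by (simp add: coprime_dvd_mult_left_iff)
  qed
  then have "degree u = 0"
    by simp
  then obtain a where a: "u = [:a:]"
    by (rule degree_eq_zeroE)
  have nonconst: "x \<noteq> to_fract [:c:]" for c
    using x by (auto simp: nonconst_rat_sols_def)
  \<comment> \<open>The zero function is one of the excluded constants.\<close>
  have "a \<noteq> 0"
    using nonconst[of 0] by (auto simp: x_eq a fract_collapse)
  define p where "p = smult (inverse a) v"
  have "p \<noteq> 0"
    using \<open>v \<noteq> 0\<close> \<open>a \<noteq> 0\<close> by (simp add: p_def)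
  have x_p: "x = Fract 1 p"
    using \<open>v \<noteq> 0\<close> \<open>a \<noteq> 0\<close> by (simp add: x_eq a p_def eq_fract)
  have "degree p \<ge> 1"
  proof (rule ccontr)
    assume "\<not> degree p \<ge> 1"
    then obtain b where b: "p = [:b:]"
      by (metis degree_eq_zeroE less_one not_le)
    then have "[:inverse b:] * p = 1"
      using \<open>p \<noteq> 0\<close> by (simp add: b)
    then have "x = to_fract [:inverse b:]"
      unfolding x_p to_fract_def eq_fract(1)[OF \<open>p \<noteq> 0\<close> one_neq_zero] by simp
    then show False
      using nonconst by blast
  qed
  moreover have "A 3 + A 2 * p ^ (n 3 - n 2) + A 1 * p ^ (n 3 - n 1) + pderiv p * p ^ (n 3 - 2) = 0"
    using x unfolding nonconst_rat_sols_def x_p mem_Collect_eq Fract_1_sol_iff[OF \<open>p \<noteq> 0\<close>] by blast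
  ultimately show "x \<in> Fract 1 ` den_sols n A"
    by (auto simp: x_p den_sols_def)
next
  fix x assume "x \<in> Fract 1 ` den_sols n A"
  then obtain p where p: "x = Fract 1 p" "degree p \<ge> 1"
    "A 3 + A 2 * p ^ (n 3 - n 2) + A 1 * p ^ (n 3 - n 1) + pderiv p * p ^ (n 3 - 2) = 0"
    by (auto simp: den_sols_def)
  then have "p \<noteq> 0"
    by auto
  have "x \<noteq> to_fract [:c:]" for c
  proof
    assume "x = to_fract [:c:]"
    then have "1 = smult c p"
      using \<open>p \<noteq> 0\<close> by (simp add: p(1) to_fract_def eq_fract)
    then have "degree (smult c p) = 0" and "c \<noteq> 0"
      by (metis degree_1) (use \<open>1 = smult c p\<close> in auto)
    then show False
      using p(2) by simp
  qed
  then show "x \<in> nonconst_rat_sols n A"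
    using p(3) unfolding nonconst_rat_sols_def p(1) mem_Collect_eq Fract_1_sol_iff[OF \<open>p \<noteq> 0\<close>] by blast
qed

lemma inj_on_den_sols: "inj_on (Fract 1) (den_sols n A)"
proof (rule inj_onI)
  fix p q assume "p \<in> den_sols n A" "q \<in> den_sols n A" "Fract 1 p = Fract 1 q"
  moreover from this have "p \<noteq> 0" "q \<noteq> 0"
    by (auto simp: den_sols_def)
  ultimately show "p = q"
    by (simp add: eq_fract)
qed

text \<open>Since \<open>1/p\<close> determines \<open>p\<close>, a fraction \<open>1/p\<close> that
  solves the equation has its own \<open>p\<close> in \<open>den_sols\<close>.\<close>

lemma Gamma_sol_eq: "Gamma_sol n A = degree ` den_sols n A"
proof -
  have "Fract 1 p \<in> Fract 1 ` den_sols n A \<longleftrightarrow> p \<in> den_sols n A" if "degree p \<ge> 1" for p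
  proof
    assume "Fract 1 p \<in> Fract 1 ` den_sols n A"
    then obtain q where "q \<in> den_sols n A" "Fract 1 p = Fract 1 q"
      by auto
    moreover have "p \<noteq> 0" "q \<noteq> 0"
      using that \<open>q \<in> den_sols n A\<close> by (auto simp: den_sols_def)
    ultimately show "p \<in> den_sols n A"
      by (simp add: eq_fract)
  qed simp
  then show ?thesis
    unfolding Gamma_sol_def nonconst_rat_sols_eq by (auto simp: den_sols_def)
qed

section \<open>Tie sets and edge polynomials\<close>

text \<open>The slope of the line \<open>Phi\<close> of the index \<open>l\<close> as a function of
  the degree; it is also the exponent that \<open>l\<close> contributes to the edge
  polynomial.\<close>

definition slope :: "nat \<Rightarrow> nat" where
  "slope l = (if l = 0 then 1 else n l)"

text \<open>Set to 0 off the tie set, so that the edge polynomial becomes a sum of four fixed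
  monomials without case distinctions.\<close>

definition tie_coeff :: "nat \<Rightarrow> nat \<Rightarrow> 'a" where
  "tie_coeff r l = (if l \<in> tie_set n A r then if l = 0 then of_nat r else lead_coeff (A l) else 0)"

lemma tie_set_iff:
  "l \<in> tie_set n A r \<longleftrightarrow>
    l \<in> {3, 2, 1, 0} \<and> (\<forall>k \<in> {3, 2, 1, 0}. Phi n A l r \<le> Phi n A k r)"
proof (cases "l \<in> {3, 2, 1, 0}")
  case True
  then have "Phi n A l r = Min ((\<lambda>k. Phi n A k r) ` {3, 2, 1, 0}) \<longleftrightarrow>
      (\<forall>k \<in> {3, 2, 1, 0}. Phi n A l r \<le> Phi n A k r)"
    by (subst eq_Min_iff) auto
  with True show ?thesis
    by (simp add: tie_set_def)
qed (simp add: tie_set_def)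

lemma finite_tie_set: "finite (tie_set n A r)"
  by (simp add: tie_set_def)

lemma tie_set_nonempty: "tie_set n A r \<noteq> {}"
proof -
  have "Min ((\<lambda>k. Phi n A k r) ` {3, 2, 1, 0}) \<in> (\<lambda>k. Phi n A k r) ` {3, 2, 1, 0}"
    by (rule Min_in) auto
  then show ?thesis
    by (force simp: tie_set_def)
qed

section \<open>How the tie set changes with the degree\<close>

lemma Phi_eq: "Phi n A l r = int (slope l) * int r - (if l = 0 then - 1 else int (degree (A l)))"
  by (simp add: Phi_def slope_def)

text \<open>Of two lines, the steeper one is not above the other at \<open>r\<close>, so it lies
  strictly below it at every \<open>s < r\<close>; the flatter one is then not minimal at
  \<open>s\<close>.\<close>

lemma tie_set_smaller_degree:
  assumes "l \<in> tie_set n A r" "k \<in> {3, 2, 1, 0}" "slope k < slope l" "s < r"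
  shows "k \<notin> tie_set n A s"
proof
  assume "k \<in> tie_set n A s"
  have l: "l \<in> {3, 2, 1, 0}" and "Phi n A l r \<le> Phi n A k r"
    using assms(1,2) by (auto simp: tie_set_iff)
  moreover have "Phi n A k s \<le> Phi n A l s"
    using \<open>k \<in> tie_set n A s\<close> l unfolding tie_set_iff by blast
  \<comment> \<open>Adding the two comparisons cancels the constant terms of the lines.\<close>
  ultimately have "(int (slope l) - int (slope k)) * (int r - int s) \<le> 0"
    by (simp add: Phi_eq algebra_simps)
  moreover have "(int (slope l) - int (slope k)) * (int r - int s) > 0"
    using assms(3,4) by simp
  ultimately show False
    by linarith
qed

section \<open>The edge polynomial and its nonzero roots\<close>

lemma edge_poly_eq:
  "edge_poly n A r = monom (tie_coeff r 3) (n 3) + monom (tie_coeff r 2) (n 2)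
    + monom (tie_coeff r 1) (n 1) + monom (tie_coeff r 0) 1"
proof -
  have "(\<Sum>l \<in> tie_set n A r \<inter> {3, 2, 1}. monom (lead_coeff (A l)) (n l)) =
      (\<Sum>l \<in> {3, 2, 1}. if l \<in> tie_set n A r then monom (lead_coeff (A l)) (n l) else 0)"
    by (simp add: sum.inter_restrict[symmetric] Int_commute)
  then show ?thesis
    by (simp add: edge_poly_def tie_coeff_def)
qed

lemma poly_edge_poly:
  "poly (edge_poly n A r) x = tie_coeff r 3 * x ^ n 3 + tie_coeff r 2 * x ^ n 2
    + tie_coeff r 1 * x ^ n 1 + tie_coeff r 0 * x"
  by (simp add: edge_poly_eq poly_monom)

lemma poly_pderiv_edge_poly:
  "poly (pderiv (edge_poly n A r)) x = of_nat (n 3) * tie_coeff r 3 * x ^ (n 3 - 1)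
    + of_nat (n 2) * tie_coeff r 2 * x ^ (n 2 - 1)
    + of_nat (n 1) * tie_coeff r 1 * x ^ (n 1 - 1) + tie_coeff r 0"
  by (simp add: edge_poly_eq poly_monom pderiv_add pderiv_monom)

text \<open>The exponents \<open>1 < n 1 < n 2 < n 3\<close> are distinct, so no two of the four
  monomials merge.\<close>

lemma coeff_edge_poly_slope:
  assumes "l \<in> {3, 2, 1, 0}"
  shows "coeff (edge_poly n A r) (slope l) = tie_coeff r l"
  using assms n1 n12 n23 by (auto simp: edge_poly_eq slope_def)

lemma coeff_edge_poly_nonzero:
  assumes "coeff (edge_poly n A r) k \<noteq> 0"
  shows "\<exists>l \<in> tie_set n A r. k = slope l"
proof (rule ccontr)
  assume no: "\<not> (\<exists>l \<in> tie_set n A r. k = slope l)"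
  have "coeff (monom (tie_coeff r l) (slope l)) k = 0" for l
    using no by (auto simp: tie_coeff_def)
  from this[of 3] this[of 2] this[of 1] this[of 0] show False
    using assms by (simp add: edge_poly_eq slope_def del: coeff_monom)
qed

lemma tie_coeff_nonzero:
  assumes "r > 0" "l \<in> tie_set n A r"
  shows "tie_coeff r l \<noteq> 0"
  using assms A1 A2 A3 by (auto simp: tie_coeff_def tie_set_iff)

lemma edge_poly_nonzero:
  assumes "r > 0"
  shows "edge_poly n A r \<noteq> 0"
proof -
  obtain l where l: "l \<in> tie_set n A r"
    using tie_set_nonempty by blast
  then have "coeff (edge_poly n A r) (slope l) \<noteq> 0"
    using coeff_edge_poly_slope[of l r] tie_coeff_nonzero[OF assms l] by (simp add: tie_set_iff)
  then show ?thesis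
    by auto
qed

text \<open>If only one index attained the minimum, the edge polynomial would be a single monomial,
  which has no nonzero root.\<close>

lemma edge_admissible_if_root:
  assumes "r > 0" "x \<noteq> 0" "poly (edge_poly n A r) x = 0"
  shows "edge_admissible n A r"
proof (rule ccontr)
  assume "\<not> edge_admissible n A r"
  then have "card (tie_set n A r) < 2"
    using assms(1) by (simp add: edge_admissible_def)
  moreover have "card (tie_set n A r) > 0"
    using finite_tie_set tie_set_nonempty by (simp add: card_gt_0_iff)
  ultimately have "card (tie_set n A r) = 1"
    by linarith
  then obtain l where l: "tie_set n A r = {l}"
    by (rule card_1_singletonE)
  then have "tie_coeff r k = 0" if "k \<noteq> l" for k
    using that by (simp add: tie_coeff_def)
  moreover have "tie_coeff r l \<noteq> 0" "l \<in> {3, 2, 1, 0}"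
    using l assms(1) tie_coeff_nonzero[of r l] tie_set_iff[of l r] by auto
  ultimately show False
    using assms(2,3) by (auto simp: poly_edge_poly)
qed

text \<open>Write the edge polynomial as \<open>X ^ e * R\<close> with \<open>R\<close> the reduced
  one. At \<open>x \<noteq> 0\<close> the power of \<open>X\<close> is a nonzero factor, so a double
  root would be a double root of \<open>R\<close>, which (ND1) excludes.\<close>

lemma simple_root_edge_poly:
  assumes "r > 0" "x \<noteq> 0" "poly (edge_poly n A r) x = 0" "ND1 n A r"
  shows "poly (pderiv (edge_poly n A r)) x \<noteq> 0"
proof
  assume deriv: "poly (pderiv (edge_poly n A r)) x = 0"
  define e where "e = order 0 (edge_poly n A r)"
  define R where "R = red_edge_poly n A r"
  have "[:0, 1:] ^ e dvd edge_poly n A r"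
    using order_1[of 0 "edge_poly n A r"] by (simp add: e_def)
  then have P: "edge_poly n A r = [:0, 1:] ^ e * R"
    by (simp add: R_def red_edge_poly_def e_def)
  have "poly R x = 0"
    using assms(2,3) by (simp add: P)
  moreover from this have "poly (pderiv R) x = 0"
    using deriv assms(2) by (simp add: P pderiv_mult)
  moreover have "R \<noteq> 0"
    using edge_poly_nonzero[OF assms(1)] by (auto simp: P)
  ultimately have "resultant R (pderiv R) = 0"
    by (intro resultant_eq_0_common_root)
  then show False
    using assms(4) by (simp add: ND1_def R_def)
qed

lemma card_nonzero_roots_edge_poly:
  assumes "r > 0" "\<And>l. l \<in> tie_set n A r \<Longrightarrow> m \<le> slope l \<and> slope l \<le> M"
  shows "finite {x. x \<noteq> 0 \<and> poly (edge_poly n A r) x = 0}"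
    and "card {x. x \<noteq> 0 \<and> poly (edge_poly n A r) x = 0} \<le> M - m"
proof -
  have "degree (edge_poly n A r) \<le> M"
    using coeff_edge_poly_nonzero[of r "degree (edge_poly n A r)"] edge_poly_nonzero[OF assms(1)] assms(2)
    by auto
  moreover have "coeff (edge_poly n A r) k = 0" if "k < m" for k
    using coeff_edge_poly_nonzero[of r k] assms(2) that by force
  ultimately show "finite {x. x \<noteq> 0 \<and> poly (edge_poly n A r) x = 0}"
    "card {x. x \<noteq> 0 \<and> poly (edge_poly n A r) x = 0} \<le> M - m"
    using card_nonzero_roots_le[OF edge_poly_nonzero[OF assms(1)]] by blast+
qed

section \<open>Ties and candidate degrees\<close>

text \<open>The candidate degrees are the points where two of the four lines \<open>Phi\<close>
  cross; each equality is solved for \<open>r\<close>, the slopes being distinct.\<close>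

lemma Phi_tie_eq_cand:
  assumes "Phi n A k r = Phi n A l r" "k \<in> {3, 2, 1, 0}" "l \<in> {3, 2, 1, 0}" "k \<noteq> l"
  shows "real r \<in> {r_pair n A 3 2, r_pair n A 3 1, r_pair n A 2 1,
    r_deriv n A 3, r_deriv n A 2, r_deriv n A 1}"
proof -
  have Phi_real: "real_of_int (Phi n A i r) =
      (if i = 0 then real r + 1 else real (n i) * real r - real (degree (A i)))" for i
    by (simp add: Phi_def)
  have pair: "real r = r_pair n A i j" if "Phi n A i r = Phi n A j r" "i \<noteq> 0" "j \<noteq> 0" "n j < n i" for i j
    using arg_cong[OF that(1), of real_of_int] that(2-4) unfolding Phi_real
    by (simp add: r_pair_def field_simps)
  have deriv: "real r = r_deriv n A i" if "Phi n A i r = Phi n A 0 r" "i \<noteq> 0" "1 < n i" for i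
    using arg_cong[OF that(1), of real_of_int] that(2,3) unfolding Phi_real
    by (simp add: r_deriv_def field_simps)
  have "n 1 < n 3" "1 < n 2" "1 < n 3"
    using n1 n12 n23 by auto
  then have cands: "Phi n A 3 r = Phi n A 2 r \<Longrightarrow> real r = r_pair n A 3 2"
    "Phi n A 3 r = Phi n A 1 r \<Longrightarrow> real r = r_pair n A 3 1"
    "Phi n A 2 r = Phi n A 1 r \<Longrightarrow> real r = r_pair n A 2 1"
    "Phi n A 3 r = Phi n A 0 r \<Longrightarrow> real r = r_deriv n A 3"
    "Phi n A 2 r = Phi n A 0 r \<Longrightarrow> real r = r_deriv n A 2"
    "Phi n A 1 r = Phi n A 0 r \<Longrightarrow> real r = r_deriv n A 1"
    using n1 n12 n23 by (auto intro!: pair deriv)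
  have "k = 3 \<or> k = 2 \<or> k = 1 \<or> k = 0" "l = 3 \<or> l = 2 \<or> l = 1 \<or> l = 0"
    using assms(2,3) by auto
  then show ?thesis
    using assms(1,4) assms(1)[symmetric] by (elim disjE; hypsubst) (blast dest: cands)+
qed

lemma Phi_tie:
  assumes "k \<in> tie_set n A r" "l \<in> {3, 2, 1, 0}"
  shows "Phi n A k r \<le> Phi n A l r" and "l \<in> tie_set n A r \<longleftrightarrow> Phi n A l r = Phi n A k r"
proof -
  show le: "Phi n A k r \<le> Phi n A l r"
    using assms unfolding tie_set_iff by blast
  have k: "k \<in> {3, 2, 1, 0}" and "\<forall>j \<in> {3, 2, 1, 0}. Phi n A k r \<le> Phi n A j r"
    using assms(1) unfolding tie_set_iff by blast+
  then show "l \<in> tie_set n A r \<longleftrightarrow> Phi n A l r = Phi n A k r"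
    using le assms(2) unfolding tie_set_iff by (metis order_antisym)
qed

text \<open>\<open>D = n\<^sub>3 r - O\<^sub>r\<close> is the top degree among the terms of the polynomial equation for the
  denominator, and the tie set consists of the terms that attain it.\<close>

lemma top_degreeE:
  assumes "r > 0"
  obtains D where
    "\<And>l. l \<in> {3, 2, 1} \<Longrightarrow> degree (A l) + (n 3 - n l) * r \<le> D"
    "\<And>l. l \<in> {3, 2, 1} \<Longrightarrow> degree (A l) + (n 3 - n l) * r = D \<longleftrightarrow> l \<in> tie_set n A r"
    "(n 3 - 1) * r \<le> D + 1" "(n 3 - 1) * r = D + 1 \<longleftrightarrow> 0 \<in> tie_set n A r"
proof -
  obtain k where k: "k \<in> tie_set n A r"
    using tie_set_nonempty by blast
  \<comment> \<open>\<open>Phi\<close> may be negative, so the difference is formed in the integers.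
    Since \<open>n 3 \<ge> 2\<close>, it is nonnegative and \<open>nat\<close> truncates
    nothing.\<close>
  define D where "D = nat (int (n 3 * r) - Phi n A k r)"
  have "Phi n A k r \<le> int r + 1"
    using Phi_tie(1)[OF k, of 0] by (simp add: Phi_def)
  also have "int r + 1 \<le> int (n 3 * r)"
  proof -
    have "2 * r \<le> n 3 * r"
      using n1 n12 n23 by (intro mult_right_mono) auto
    then show ?thesis
      using assms by linarith
  qed
  finally have D: "int D = int (n 3 * r) - Phi n A k r"
    by (simp add: D_def)
  have top: "int (degree (A l) + (n 3 - n l) * r) = int (n 3 * r) - Phi n A l r" if "l \<in> {3, 2, 1}" for l
  proof -
    have "n l \<le> n 3" "l \<noteq> 0"
      using that n12 n23 by auto
    then show ?thesis
      unfolding of_nat_add of_nat_mult of_nat_diff[OF \<open>n l \<le> n 3\<close>] by (simp add: Phi_def algebra_simps)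
  qed
  \<comment> \<open>The derivative term has degree bound \<open>(r - 1) + (n 3 - 2) * r\<close>, one
    less than \<open>(n 3 - 1) * r\<close>; hence the \<open>+ 1\<close> here and the
    \<open>D + 1\<close> in the conclusion.\<close>
  have top0: "int ((n 3 - 1) * r) = int (n 3 * r) - Phi n A 0 r + 1"
    using n1 n12 n23 by (simp add: Phi_def of_nat_diff algebra_simps)
  show ?thesis
  proof
    fix l :: nat assume l: "l \<in> {3, 2, 1}"
    then have l': "l \<in> {3, 2, 1, 0}"
      by blast
    show "degree (A l) + (n 3 - n l) * r \<le> D"
      using top[OF l] Phi_tie(1)[OF k l'] D by linarith
    show "degree (A l) + (n 3 - n l) * r = D \<longleftrightarrow> l \<in> tie_set n A r"
      using top[OF l] Phi_tie(2)[OF k l'] D by linarith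
  next
    show "(n 3 - 1) * r \<le> D + 1"
    proof -
      have "Phi n A k r \<le> Phi n A 0 r"
        using Phi_tie(1)[OF k] by blast
      then show ?thesis
        using top0 D by linarith
    qed
    show "(n 3 - 1) * r = D + 1 \<longleftrightarrow> 0 \<in> tie_set n A r"
    proof -
      have "0 \<in> tie_set n A r \<longleftrightarrow> Phi n A 0 r = Phi n A k r"
        using Phi_tie(2)[OF k] by blast
      then show ?thesis
        using top0 D by linarith
    qed
  qed
qed

section \<open>The top coefficient of the equation for the denominator\<close>

text \<open>The chain rule read backwards. It expresses the derivative term by a power of
  \<open>p\<close>, whose coefficients are known.\<close>

lemma pderiv_mult_power:
  "pderiv p * p ^ (n 3 - 2) = smult (inverse (of_nat (n 3 - 1))) (pderiv (p ^ (n 3 - 1)))"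
  for p :: "'a poly"
proof -
  have "n 3 - 1 - 1 = n 3 - 2"
    by simp
  moreover have "of_nat (n 3 - 1) \<noteq> (0::'a)"
    using n1 n12 n23 unfolding of_nat_eq_0_iff by linarith
  ultimately show ?thesis
    by (simp add: pderiv_power mult.commute)
qed

text \<open>The coefficient of the equation at the top degree \<open>D\<close> collects exactly the
  tied terms. Divided by \<open>c ^ n 3\<close>, it is the edge polynomial at
  \<open>1/c\<close>.\<close>

lemma edge_poly_root:
  assumes "p \<in> den_sols n A"
  shows "poly (edge_poly n A (degree p)) (inverse (lead_coeff p)) = 0"
proof -
  define r where "r = degree p"
  define c where "c = lead_coeff p"
  have "r > 0"
    using assms by (simp add: den_sols_def r_def)
  then have "c \<noteq> 0"
    by (auto simp: r_def c_def)
  obtain D where D: "\<And>l. l \<in> {3, 2, 1} \<Longrightarrow> degree (A l) + (n 3 - n l) * r \<le> D"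
    "\<And>l. l \<in> {3, 2, 1} \<Longrightarrow> degree (A l) + (n 3 - n l) * r = D \<longleftrightarrow> l \<in> tie_set n A r"
    "(n 3 - 1) * r \<le> D + 1" "(n 3 - 1) * r = D + 1 \<longleftrightarrow> 0 \<in> tie_set n A r"
    using \<open>r > 0\<close> by (rule top_degreeE) (rule that)
  have deg: "degree (p ^ k) \<le> k * r" and coeff: "coeff (p ^ k) (k * r) = c ^ k" for k
    by (simp_all add: degree_power_le_mult coeff_power_at_degree_bound r_def c_def)
  have coeff_term: "coeff (A l * p ^ (n 3 - n l)) D = tie_coeff r l * c ^ (n 3 - n l)"
    if "l \<in> {3, 2, 1}" for l
  proof -
    have "l \<noteq> 0"
      using that by auto
    then show ?thesis
      using coeff_mult_at_degree_bounds[OF order_refl deg D(1)[OF that]] D(2)[OF that]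
      by (simp add: coeff tie_coeff_def)
  qed
  have nz: "of_nat (n 3 - 1) \<noteq> (0::'a)"
    using n1 n12 n23 unfolding of_nat_eq_0_iff by linarith
  have coeff_term0: "coeff (pderiv p * p ^ (n 3 - 2)) D = tie_coeff r 0 * c ^ (n 3 - 1)"
  proof (cases "0 \<in> tie_set n A r")
    case True
    then have "Suc D = (n 3 - 1) * r"
      using D(4) by simp
    \<comment> \<open>Taking the coefficient at \<open>D\<close> of a derivative produces the factor
      \<open>D + 1 = (n 3 - 1) * r\<close>, of which \<open>r\<close> remains after
      cancellation.\<close>
    then have "coeff (pderiv p * p ^ (n 3 - 2)) D =
        inverse (of_nat (n 3 - 1)) * (of_nat (n 3 - 1) * of_nat r) * c ^ (n 3 - 1)"
      unfolding pderiv_mult_power coeff_smult coeff_pderiv by (simp only: coeff of_nat_mult mult.assoc)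
    then show ?thesis
      using True nz by (simp add: tie_coeff_def)
  next
    case False
    then have "degree (p ^ (n 3 - 1)) < Suc D"
      using D(3,4) deg[of "n 3 - 1"] by linarith
    then show ?thesis
      unfolding pderiv_mult_power coeff_smult coeff_pderiv
      using False by (simp add: coeff_eq_0 tie_coeff_def)
  qed
  \<comment> \<open>The trivial factor \<open>p ^ (n 3 - n 3)\<close> gives the term of
    \<open>A 3\<close> the same shape as the other two.\<close>
  have "coeff (A 3 * p ^ (n 3 - n 3) + A 2 * p ^ (n 3 - n 2) + A 1 * p ^ (n 3 - n 1)
      + pderiv p * p ^ (n 3 - 2)) D = 0"
    using assms by (simp add: den_sols_def)
  then have eq: "tie_coeff r 3 * c ^ (n 3 - n 3) + tie_coeff r 2 * c ^ (n 3 - n 2)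
      + tie_coeff r 1 * c ^ (n 3 - n 1) + tie_coeff r 0 * c ^ (n 3 - 1) = 0"
    using coeff_term[of 3] coeff_term[of 2] coeff_term[of 1] coeff_term0 by simp
  note pow = power_diff_mult_inverse[OF \<open>c \<noteq> 0\<close>, of _ "n 3"]
  have "poly (edge_poly n A r) (inverse c) = (tie_coeff r 3 * c ^ (n 3 - n 3)
      + tie_coeff r 2 * c ^ (n 3 - n 2)
      + tie_coeff r 1 * c ^ (n 3 - n 1) + tie_coeff r 0 * c ^ (n 3 - 1)) * inverse c ^ n 3"
    using pow[of "n 3"] pow[of "n 2"] pow[of "n 1"] pow[of 1] n1 n12 n23
    unfolding poly_edge_poly distrib_right mult.assoc by simp
  then show ?thesis
    unfolding eq by (simp add: r_def c_def)
qed

text \<open>The nonzero root \<open>1/c\<close> of the edge polynomial forces two tied indices, so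
  \<open>r\<close> is a crossing point of two lines. The upper bound \<open>r_zero\<close> is a
  divisibility statement about \<open>A 3\<close>.\<close>

lemma Gamma_cand_if_den_sol:
  assumes "p \<in> den_sols n A"
  shows "degree p \<in> Gamma_cand n A" and "edge_admissible n A (degree p)"
proof -
  define r where "r = degree p"
  have "r > 0" "p \<noteq> 0"
    using assms by (auto simp: den_sols_def r_def)
  show "edge_admissible n A (degree p)"
    using edge_poly_root[OF assms] \<open>r > 0\<close> \<open>p \<noteq> 0\<close>
    by (intro edge_admissible_if_root[of _ "inverse (lead_coeff p)"]) (auto simp: r_def)
  then have "card (tie_set n A r) \<ge> 2"
    by (simp add: edge_admissible_def r_def)
  then obtain T where "T \<subseteq> tie_set n A r" "card T = 2"
    by (rule obtain_subset_with_card_n)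
  then obtain k l where kl: "k \<in> tie_set n A r" "l \<in> tie_set n A r" "k \<noteq> l"
    by (auto simp: card_2_iff)
  moreover have "k \<in> {3, 2, 1, 0}" "l \<in> {3, 2, 1, 0}"
    using kl(1,2) unfolding tie_set_iff by blast+
  ultimately have cand: "real r \<in> {r_pair n A 3 2, r_pair n A 3 1, r_pair n A 2 1,
      r_deriv n A 3, r_deriv n A 2, r_deriv n A 1}"
    using Phi_tie(2)[OF kl(2), of k] by (intro Phi_tie_eq_cand[of k r l]) auto
  \<comment> \<open>\<open>n 3 - n 2\<close> is the least exponent of \<open>p\<close> in these
    terms, because \<open>n 1 < n 2\<close> and \<open>2 \<le> n 2\<close>; by the equation this
    power of \<open>p\<close> also divides \<open>A 3\<close>.\<close>
  have "p ^ (n 3 - n 2) dvd A 2 * p ^ (n 3 - n 2) + A 1 * p ^ (n 3 - n 1) + pderiv p * p ^ (n 3 - 2)"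
    using n1 n12 n23 by (intro dvd_add dvd_mult le_imp_power_dvd) auto
  moreover have "A 3 + (A 2 * p ^ (n 3 - n 2) + A 1 * p ^ (n 3 - n 1) + pderiv p * p ^ (n 3 - 2)) = 0"
    using assms by (simp add: den_sols_def add.assoc)
  then have "A 3 = - (A 2 * p ^ (n 3 - n 2) + A 1 * p ^ (n 3 - n 1) + pderiv p * p ^ (n 3 - 2))"
    by (simp only: eq_neg_iff_add_eq_0)
  ultimately have "p ^ (n 3 - n 2) dvd A 3"
    by (simp only: dvd_minus_iff)
  then have "degree (p ^ (n 3 - n 2)) \<le> degree (A 3)"
    using A3 by (rule dvd_imp_degree_le)
  then have "(n 3 - n 2) * r \<le> degree (A 3)"
    using \<open>p \<noteq> 0\<close> by (simp add: degree_power_eq r_def mult.commute)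
  then have "real ((n 3 - n 2) * r) \<le> real (degree (A 3))"
    by (rule of_nat_mono)
  then have "real r \<le> r_zero n A"
    using n23 by (simp add: r_zero_def field_simps of_nat_diff)
  then show "degree p \<in> Gamma_cand n A"
    using cand \<open>r > 0\<close> unfolding Gamma_cand_def r_def by simp
qed

section \<open>Uniqueness for given degree and leading coefficient\<close>

text \<open>If \<open>p - q\<close> has degree \<open>s < r\<close>, comparing coefficients in the difference of the two equations
  gives \<open>P\<^sub>r'(C) = s - r\<close> when the derivative term is tied and \<open>P\<^sub>r'(C) = 0\<close> otherwise.\<close>

lemma den_sols_eqI:
  assumes p: "p \<in> den_sols n A" and q: "q \<in> den_sols n A"
    and deg_eq: "degree p = degree q" and lc_eq: "lead_coeff p = lead_coeff q"
    and ND: "ND1 n A (degree p)" "ND2 n A (degree p)"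
  shows "p = q"
proof (rule ccontr)
  assume "p \<noteq> q"
  define r where "r = degree p"
  define c where "c = lead_coeff p"
  define x where "x = inverse c"
  define s where "s = degree (p - q)"
  define h where "h = lead_coeff (p - q)"
  define d :: 'a where "d = (if 0 \<in> tie_set n A r then 1 else 0)"
  have "r > 0"
    using p by (simp add: den_sols_def r_def)
  then have "c \<noteq> 0"
    by (auto simp: r_def c_def)
  then have "x \<noteq> 0"
    by (simp add: x_def)
  have "h \<noteq> 0"
    using \<open>p \<noteq> q\<close> unfolding h_def leading_coeff_0_iff by simp
  have "s \<le> r"
    unfolding s_def r_def by (rule degree_diff_le) (simp_all add: deg_eq)
  moreover have "s \<noteq> r"
    using \<open>h \<noteq> 0\<close> lc_eq deg_eq by (auto simp: h_def s_def r_def)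
  ultimately have "s < r"
    by simp
  have degs: "degree p \<le> r" "degree q \<le> r" "degree (p - q) \<le> s" "coeff p r = c" "coeff q r = c"
    using deg_eq lc_eq by (simp_all add: r_def s_def c_def)
  note deg = power_diff_at_degree_bounds(1)[OF degs(1-3)]
  have coeff: "coeff (p ^ k - q ^ k) (s + (k - 1) * r) = of_nat k * c ^ (k - 1) * h" for k
    using coeff_power_diff[OF degs, of k] by (simp add: h_def s_def)
  obtain D where D: "\<And>l. l \<in> {3, 2, 1} \<Longrightarrow> degree (A l) + (n 3 - n l) * r \<le> D"
    "\<And>l. l \<in> {3, 2, 1} \<Longrightarrow> degree (A l) + (n 3 - n l) * r = D \<longleftrightarrow> l \<in> tie_set n A r"
    "(n 3 - 1) * r \<le> D + 1" "(n 3 - 1) * r = D + 1 \<longleftrightarrow> 0 \<in> tie_set n A r"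
    using \<open>r > 0\<close> by (rule top_degreeE) (rule that)
  have pred_mult: "(k - 1) * r + r = k * r" if "k > 0" for k
    using that by (cases k) (simp_all add: One_nat_def)
  have "2 * r \<le> (n 3 - 1) * r"
    using n1 n12 n23 by (intro mult_right_mono) auto
  then have "r \<le> D"
    using D(3) \<open>r > 0\<close> by linarith
  \<comment> \<open>In a term of top degree \<open>D\<close>, one factor \<open>p\<close> of degree
    \<open>r\<close> is replaced by \<open>p - q\<close> of degree \<open>s\<close>, so the
    difference of the equations is compared at \<open>D - r + s\<close>.\<close>
  define e where "e = D - r + s"
  have e: "e + r = D + s"
    using \<open>r \<le> D\<close> by (simp add: e_def)
  have coeff_term: "coeff (A l * (p ^ (n 3 - n l) - q ^ (n 3 - n l))) e =
      tie_coeff r l * (of_nat (n 3 - n l) * c ^ (n 3 - n l - 1) * h)" if "l \<in> {2, 1}" for l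
  proof -
    have l: "l \<in> {3, 2, 1}" "l \<noteq> 0" "n 3 - n l > 0"
      using that n12 n23 by auto
    have "degree (A l) + (s + (n 3 - n l - 1) * r) \<le> e"
      using D(1)[OF l(1)] pred_mult[OF l(3)] e by linarith
    moreover have "degree (A l) + (s + (n 3 - n l - 1) * r) = e \<longleftrightarrow> l \<in> tie_set n A r"
      unfolding D(2)[OF l(1), symmetric] using pred_mult[OF l(3)] e by linarith
    ultimately show ?thesis
      using coeff_mult_at_degree_bounds[OF order_refl deg, of "A l" "n 3 - n l" e] l(2)
      unfolding coeff by (auto simp: tie_coeff_def)
  qed
  have n3: "n 3 - 1 - 1 = n 3 - 2" "n 3 - 1 > 0"
    using n1 n12 n23 by simp_all
  have nz: "of_nat (n 3 - 1) \<noteq> (0::'a)"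
    using n3(2) by (simp only: of_nat_eq_0_iff)
  have coeff_term0: "coeff (smult (inverse (of_nat (n 3 - 1))) (pderiv (p ^ (n 3 - 1) - q ^ (n 3 - 1)))) e =
      d * (of_nat (s + (n 3 - 2) * r) * c ^ (n 3 - 2) * h)"
  proof (cases "0 \<in> tie_set n A r")
    case True
    \<comment> \<open>The degree bound of \<open>p ^ (n 3 - 1) - q ^ (n 3 - 1)\<close>.
      Differentiation turns it into the factor \<open>s + (n 3 - 2) * r\<close>, which is how
      \<open>s\<close> enters the relation.\<close>
    then have Suc_e: "Suc e = s + (n 3 - 1 - 1) * r"
      using D(4) pred_mult[OF n3(2)] e by linarith
    have "coeff (smult (inverse (of_nat (n 3 - 1))) (pderiv (p ^ (n 3 - 1) - q ^ (n 3 - 1)))) e =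
        inverse (of_nat (n 3 - 1)) * (of_nat (s + (n 3 - 2) * r) * (of_nat (n 3 - 1) * c ^ (n 3 - 2) * h))"
      unfolding coeff_smult coeff_pderiv Suc_e coeff unfolding n3(1) ..
    also have "\<dots> = (inverse (of_nat (n 3 - 1)) * of_nat (n 3 - 1)) *
        (of_nat (s + (n 3 - 2) * r) * c ^ (n 3 - 2) * h)"
      by (simp only: ac_simps)
    finally show ?thesis
      using True nz by (simp add: d_def)
  next
    case False
    then have "s + (n 3 - 1 - 1) * r < Suc e"
      using D(3,4) pred_mult[OF n3(2)] e by linarith
    then have "degree (p ^ (n 3 - 1) - q ^ (n 3 - 1)) < Suc e"
      using deg[of "n 3 - 1"] by linarith
    then have "coeff (p ^ (n 3 - 1) - q ^ (n 3 - 1)) (Suc e) = 0"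
      by (rule coeff_eq_0)
    then show ?thesis
      using False unfolding coeff_smult coeff_pderiv by (simp only: d_def) simp
  qed
  have "A 2 * (p ^ (n 3 - n 2) - q ^ (n 3 - n 2)) + A 1 * (p ^ (n 3 - n 1) - q ^ (n 3 - n 1))
      + (pderiv p * p ^ (n 3 - 2) - pderiv q * q ^ (n 3 - 2)) =
      (A 3 + A 2 * p ^ (n 3 - n 2) + A 1 * p ^ (n 3 - n 1) + pderiv p * p ^ (n 3 - 2))
      - (A 3 + A 2 * q ^ (n 3 - n 2) + A 1 * q ^ (n 3 - n 1) + pderiv q * q ^ (n 3 - 2))"
    unfolding right_diff_distrib by simp
  also have "\<dots> = 0"
    using p q by (simp add: den_sols_def)
  finally have "coeff (A 2 * (p ^ (n 3 - n 2) - q ^ (n 3 - n 2)) + A 1 * (p ^ (n 3 - n 1) - q ^ (n 3 - n 1))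
      + smult (inverse (of_nat (n 3 - 1))) (pderiv (p ^ (n 3 - 1) - q ^ (n 3 - 1)))) e = 0"
    unfolding pderiv_mult_power pderiv_diff smult_diff_right by simp
  then have "(tie_coeff r 2 * of_nat (n 3 - n 2) * c ^ (n 3 - n 2 - 1)
      + tie_coeff r 1 * of_nat (n 3 - n 1) * c ^ (n 3 - n 1 - 1)
      + d * of_nat (s + (n 3 - 2) * r) * c ^ (n 3 - 2)) * h = 0"
    unfolding coeff_add coeff_term0 using coeff_term[of 2] coeff_term[of 1] by (simp add: algebra_simps)
  then have lin: "tie_coeff r 2 * of_nat (n 3 - n 2) * c ^ (n 3 - n 2 - 1)
      + tie_coeff r 1 * of_nat (n 3 - n 1) * c ^ (n 3 - n 1 - 1)
      + d * of_nat (s + (n 3 - 2) * r) * c ^ (n 3 - 2) = 0"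
    using \<open>h \<noteq> 0\<close> by simp
  have pow: "c ^ (n 3 - k - 1) * x ^ (n 3 - 2) = x ^ (k - 1)" if "1 \<le> k" "k < n 3" for k
  proof -
    have "n 3 - 2 - (k - 1) = n 3 - k - 1" "k - 1 \<le> n 3 - 2"
      using that by simp_all
    then show ?thesis
      using power_diff_mult_inverse[OF \<open>c \<noteq> 0\<close>, of "k - 1" "n 3 - 2"] by (simp only: x_def)
  qed
  \<comment> \<open>Multiplication by \<open>x ^ (n 3 - 2)\<close> replaces the powers of
    \<open>c\<close> by powers of the root \<open>x = 1/c\<close>.\<close>
  have "(tie_coeff r 2 * of_nat (n 3 - n 2) * c ^ (n 3 - n 2 - 1)
      + tie_coeff r 1 * of_nat (n 3 - n 1) * c ^ (n 3 - n 1 - 1)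
      + d * of_nat (s + (n 3 - 2) * r) * c ^ (n 3 - 2)) * x ^ (n 3 - 2) =
      tie_coeff r 2 * (of_nat (n 3) - of_nat (n 2)) * x ^ (n 2 - 1)
      + tie_coeff r 1 * (of_nat (n 3) - of_nat (n 1)) * x ^ (n 1 - 1)
      + d * (of_nat s + (of_nat (n 3) - 2) * of_nat r)"
  proof -
    have "c ^ (n 3 - 2) * x ^ (n 3 - 2) = 1"
      using power_diff_mult_inverse[OF \<open>c \<noteq> 0\<close>, of 0 "n 3 - 2"] by (simp add: x_def)
    then show ?thesis
      using pow[of "n 2"] pow[of "n 1"] n1 n12 n23
      unfolding distrib_right mult.assoc by (simp add: of_nat_diff)
  qed
  then have lin': "tie_coeff r 2 * (of_nat (n 3) - of_nat (n 2)) * x ^ (n 2 - 1)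
      + tie_coeff r 1 * (of_nat (n 3) - of_nat (n 1)) * x ^ (n 1 - 1)
      + d * (of_nat s + (of_nat (n 3) - 2) * of_nat r) = 0"
    unfolding lin by simp
  have root: "poly (edge_poly n A r) x = 0"
    using edge_poly_root[OF p] by (simp add: x_def c_def r_def)
  have pow1: "x ^ k = x ^ (k - 1) * x" if "k > 0" for k
    using power_minus_mult[OF that] by (rule sym)
  have "poly (edge_poly n A r) x = (tie_coeff r 3 * x ^ (n 3 - 1) + tie_coeff r 2 * x ^ (n 2 - 1)
      + tie_coeff r 1 * x ^ (n 1 - 1) + d * of_nat r) * x"
    using pow1[of "n 3"] pow1[of "n 2"] pow1[of "n 1"] n1 n12 n23
    unfolding poly_edge_poly distrib_right mult.assoc by (simp add: tie_coeff_def d_def)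
  then have root': "tie_coeff r 3 * x ^ (n 3 - 1) + tie_coeff r 2 * x ^ (n 2 - 1)
      + tie_coeff r 1 * x ^ (n 1 - 1) + d * of_nat r = 0"
    using root \<open>x \<noteq> 0\<close> by simp
  have "tie_coeff r 0 = d * of_nat r"
    by (simp add: tie_coeff_def d_def)
  \<comment> \<open>The first bracket is the edge polynomial at \<open>x\<close> divided by
    \<open>x\<close>, and the second is the left side of \<open>lin'\<close>. Both vanish, so only
    the last summand survives.\<close>
  then have "poly (pderiv (edge_poly n A r)) x =
      of_nat (n 3) * (tie_coeff r 3 * x ^ (n 3 - 1) + tie_coeff r 2 * x ^ (n 2 - 1)
        + tie_coeff r 1 * x ^ (n 1 - 1) + d * of_nat r)
      - (tie_coeff r 2 * (of_nat (n 3) - of_nat (n 2)) * x ^ (n 2 - 1)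
        + tie_coeff r 1 * (of_nat (n 3) - of_nat (n 1)) * x ^ (n 1 - 1)
        + d * (of_nat s + (of_nat (n 3) - 2) * of_nat r))
      + d * (of_nat s - of_nat r)"
    unfolding poly_pderiv_edge_poly by (simp add: algebra_simps)
  then have deriv: "poly (pderiv (edge_poly n A r)) x = d * (of_nat s - of_nat r)"
    unfolding lin' root' by simp
  show False
  proof (cases "0 \<in> tie_set n A r")
    case True
    then have "poly (pderiv (edge_poly n A r)) x = of_int (int s - int r)"
      by (simp add: deriv d_def)
    moreover have "int s - int r < 0"
      using \<open>s < r\<close> by simp
    ultimately show False
      using ND(2) True root \<open>x \<noteq> 0\<close> unfolding ND2_def r_def[symmetric] by blast
  next
    case False
    then show False
      using simple_root_edge_poly[OF \<open>r > 0\<close> \<open>x \<noteq> 0\<close> root] ND(1) deriv by (simp add: r_def d_def)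
  qed
qed

end

section \<open>Counting solutions\<close>

locale nondeg_power_ode = power_ode +
  assumes ND: "\<And>r. r \<in> Gamma_cand n A \<Longrightarrow> edge_admissible n A r \<Longrightarrow> ND1 n A r \<and> ND2 n A r"
begin

section \<open>Solutions of one degree\<close>

text \<open>Sending \<open>p\<close> to the inverse of its leading coefficient is injective on the
  solutions of degree \<open>r\<close> and maps them to nonzero roots of the edge
  polynomial.\<close>

lemma den_sols_of_degree:
  assumes "r > 0" "\<And>l. l \<in> tie_set n A r \<Longrightarrow> m \<le> slope l \<and> slope l \<le> M"
  shows "finite {p \<in> den_sols n A. degree p = r}"
    and "card {p \<in> den_sols n A. degree p = r} \<le> M - m"
proof -
  define F where "F = {p \<in> den_sols n A. degree p = r}"
  define R where "R = {x. x \<noteq> 0 \<and> poly (edge_poly n A r) x = 0}"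
  have R: "finite R" "card R \<le> M - m"
    using card_nonzero_roots_edge_poly[OF assms] by (simp_all add: R_def)
  have inj: "inj_on (\<lambda>p. inverse (lead_coeff p)) F"
  proof (rule inj_onI)
    fix p q assume pq: "p \<in> F" "q \<in> F" "inverse (lead_coeff p) = inverse (lead_coeff q)"
    then have "ND1 n A (degree p) \<and> ND2 n A (degree p)"
      using ND Gamma_cand_if_den_sol[of p] by (simp add: F_def)
    then show "p = q"
      using pq by (intro den_sols_eqI) (auto simp: F_def)
  qed
  have img: "(\<lambda>p. inverse (lead_coeff p)) ` F \<subseteq> R"
    using edge_poly_root assms(1) by (auto simp: F_def R_def)
  show "finite {p \<in> den_sols n A. degree p = r}"
    using inj_on_finite[OF inj img R(1)] by (simp add: F_def)
  show "card {p \<in> den_sols n A. degree p = r} \<le> M - m"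
    using card_inj_on_le[OF inj img R(1)] R(2) by (simp add: F_def)
qed

lemma degree_den_sols_pos: "p \<in> den_sols n A \<Longrightarrow> degree p > 0"
  by (simp add: den_sols_def)

text \<open>The degrees are bounded by \<open>r_zero\<close>, and each degree occurs finitely often.
  Finiteness gives \<open>card\<close> and \<open>Max\<close> their intended meaning.\<close>

lemma finite_den_sols: "finite (den_sols n A)"
proof -
  have "degree ` den_sols n A \<subseteq> {..nat \<lfloor>r_zero n A\<rfloor>}"
  proof (rule image_subsetI)
    fix p assume "p \<in> den_sols n A"
    then have "real (degree p) \<le> r_zero n A"
      using Gamma_cand_if_den_sol(1) by (simp add: Gamma_cand_def)
    then show "degree p \<in> {..nat \<lfloor>r_zero n A\<rfloor>}"
      by (simp add: le_nat_floor)
  qed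
  then have "finite (degree ` den_sols n A)"
    by (rule finite_subset) simp
  moreover have "finite {p \<in> den_sols n A. degree p = r}" if "r \<in> degree ` den_sols n A" for r
  proof (rule den_sols_of_degree(1))
    show "r > 0"
      using that degree_den_sols_pos by auto
    show "0 \<le> slope l \<and> slope l \<le> n 3" if "l \<in> tie_set n A r" for l
      using that n1 n12 n23 by (auto simp: tie_set_iff slope_def)
  qed
  ultimately have "finite (\<Union>r \<in> degree ` den_sols n A. {p \<in> den_sols n A. degree p = r})"
    by blast
  then show ?thesis
    by (rule finite_subset[rotated]) blast
qed

section \<open>Solutions of different degrees\<close>

lemma card_tie_set_den_sol: "p \<in> den_sols n A \<Longrightarrow> card (tie_set n A (degree p)) \<ge> 2"
  using Gamma_cand_if_den_sol(2) by (simp add: edge_admissible_def)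

lemma tie_set_subset: "tie_set n A r \<subseteq> {3, 2, 1, 0}"
  unfolding tie_set_def by blast

text \<open>The line of index 3 is the steepest, so at a smaller degree the three other indices
  leave the tie set, whereas a solution needs two tied indices.\<close>

lemma degree_eq_if_3_tied:
  assumes "p \<in> den_sols n A" "q \<in> den_sols n A" "3 \<in> tie_set n A (degree p)" "degree q \<le> degree p"
  shows "degree q = degree p"
proof (rule ccontr)
  assume "degree q \<noteq> degree p"
  then have lt: "degree q < degree p"
    using assms(4) by simp
  have "slope 2 < slope 3" "slope 1 < slope 3" "slope 0 < slope 3"
    using n1 n12 n23 by (simp_all add: slope_def)
  then have "2 \<notin> tie_set n A (degree q)" "1 \<notin> tie_set n A (degree q)" "0 \<notin> tie_set n A (degree q)"
    using tie_set_smaller_degree[OF assms(3) _ _ lt] by blast+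
  then have "tie_set n A (degree q) \<subseteq> {3}"
    using tie_set_subset[of "degree q"] by blast
  then have "card (tie_set n A (degree q)) \<le> card {3::nat}"
    by (rule card_mono[rotated]) simp
  then show False
    using card_tie_set_den_sol[OF assms(2)] by simp
qed

text \<open>The flatter lines of 1 and \<partial> drop out below \<open>r\<close>, and a solution
  needs both of the remaining indices.\<close>

lemma tie_set_below_2_tied:
  assumes "q \<in> den_sols n A" "2 \<in> tie_set n A r" "degree q < r"
  shows "tie_set n A (degree q) = {3, 2}"
proof -
  have "slope 1 < slope 2" "slope 0 < slope 2"
    using n1 n12 n23 by (simp_all add: slope_def)
  then have "1 \<notin> tie_set n A (degree q)" "0 \<notin> tie_set n A (degree q)"
    using tie_set_smaller_degree[OF assms(2) _ _ assms(3)] by blast+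
  then have sub: "tie_set n A (degree q) \<subseteq> {3, 2}"
    using tie_set_subset[of "degree q"] by blast
  show ?thesis
    using sub card_tie_set_den_sol[OF assms(1)] by (intro card_seteq) simp_all
qed

text \<open>All solutions share the maximal degree, where the tied exponents lie between
  \<open>m\<close> and \<open>n 3\<close>.\<close>

lemma card_den_sols_if_3_tied:
  assumes "p \<in> den_sols n A" "\<And>q. q \<in> den_sols n A \<Longrightarrow> degree q \<le> degree p"
    and "3 \<in> tie_set n A (degree p)"
    and "\<And>l. l \<in> tie_set n A (degree p) \<Longrightarrow> m \<le> slope l"
  shows "card (den_sols n A) \<le> n 3 - m"
proof -
  have "den_sols n A = {q \<in> den_sols n A. degree q = degree p}"
    using degree_eq_if_3_tied[OF assms(1) _ assms(3)] assms(2) by blast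
  moreover have "slope l \<le> n 3" if "l \<in> tie_set n A (degree p)" for l
    using that n1 n12 n23 by (auto simp: tie_set_iff slope_def)
  ultimately show ?thesis
    using den_sols_of_degree(2)[OF degree_den_sols_pos[OF assms(1)], of m "n 3"] assms(4) by simp
qed

text \<open>There are at most two layers: the maximal degree, with tied exponents between
  \<open>m\<close> and \<open>n 2\<close>, and one smaller degree with tie set
  \<open>{3, 2}\<close>.\<close>

lemma card_den_sols_if_2_tied:
  assumes p: "p \<in> den_sols n A" and max: "\<And>q. q \<in> den_sols n A \<Longrightarrow> degree q \<le> degree p"
    and tied: "2 \<in> tie_set n A (degree p)"
    and slopes: "\<And>l. l \<in> tie_set n A (degree p) \<Longrightarrow> m \<le> slope l \<and> slope l \<le> n 2"
  shows "card (den_sols n A) \<le> (n 2 - m) + (n 3 - n 2)"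
proof -
  define T where "T = {q \<in> den_sols n A. degree q = degree p}"
  define B where "B = {q \<in> den_sols n A. degree q < degree p}"
  have "card T \<le> n 2 - m"
    unfolding T_def using degree_den_sols_pos[OF p] slopes by (rule den_sols_of_degree(2))
  moreover have "card B \<le> n 3 - n 2"
  proof (cases "B = {}")
    case False
    then obtain q where q: "q \<in> den_sols n A" "degree q < degree p"
      by (auto simp: B_def)
    \<comment> \<open>Index 3 is tied at both smaller degrees, so the larger of the two admits no
      solution of lower degree.\<close>
    have same: "degree q' = degree q" if q': "q' \<in> den_sols n A" "degree q' < degree p" for q'
    proof (cases "degree q' \<le> degree q")
      case True
      then show ?thesis
        using degree_eq_if_3_tied[OF q(1) q'(1)] tie_set_below_2_tied[OF q(1) tied q(2)] by simp
    next
      case False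
      then show ?thesis
        using degree_eq_if_3_tied[OF q'(1) q(1)] tie_set_below_2_tied[OF q'(1) tied q'(2)] by simp
    qed
    have "B = {q' \<in> den_sols n A. degree q' = degree q}"
      unfolding B_def by (rule Collect_cong) (metis same q(2))
    moreover have "n 2 \<le> slope l \<and> slope l \<le> n 3" if "l \<in> tie_set n A (degree q)" for l
      using that n23 unfolding tie_set_below_2_tied[OF q(1) tied q(2)] by (auto simp: slope_def)
    ultimately show ?thesis
      using den_sols_of_degree(2)[OF degree_den_sols_pos[OF q(1)], of "n 2" "n 3"] by simp
  qed simp
  moreover have "den_sols n A = T \<union> B"
    using max by (auto simp: T_def B_def order_le_less)
  ultimately show ?thesis
    using card_Un_le[of T B] by simp
qed

text \<open>For \<open>T\<^sub>r = {2, \<partial>}\<close> every nonzero root \<open>C\<close> of \<open>P\<^sub>r\<close> has \<open>P\<^sub>r'(C) = - (n\<^sub>2 - 1) r\<close>,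
  which (ND2) forbids.\<close>

lemma tie_set_if_C1:
  assumes p: "p \<in> den_sols n A" and C1: "C1 n A (degree p)"
  shows "tie_set n A (degree p) = {3, 2, 0}"
proof -
  define r where "r = degree p"
  define x where "x = inverse (lead_coeff p)"
  have "r > 0"
    using degree_den_sols_pos[OF p] by (simp add: r_def)
  then have "x \<noteq> 0"
    by (auto simp: x_def r_def)
  have card: "card (tie_set n A r) \<ge> 2"
    using card_tie_set_den_sol[OF p] by (simp add: r_def)
  \<comment> \<open>(C1) says that the lines of 2 and \<partial> meet at \<open>r\<close>, strictly
    below the line of 1.\<close>
  have Phi: "Phi n A 2 r = Phi n A 0 r" "Phi n A 0 r < Phi n A 1 r"
    using C1 by (simp_all add: C1_def Phi_def r_def algebra_simps)
  have not1: "1 \<notin> tie_set n A r"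
    using Phi(2) unfolding tie_set_iff by (meson insertCI not_le)
  have iff: "2 \<in> tie_set n A r \<longleftrightarrow> 0 \<in> tie_set n A r"
    unfolding tie_set_iff Phi(1) by blast
  have "2 \<in> tie_set n A r"
  proof (rule ccontr)
    assume "2 \<notin> tie_set n A r"
    then have "tie_set n A r \<subseteq> {3}"
      using not1 iff tie_set_subset[of r] by blast
    then have "card (tie_set n A r) \<le> card {3::nat}"
      by (rule card_mono[rotated]) simp
    then show False
      using card by simp
  qed
  moreover have "3 \<in> tie_set n A r"
  proof (rule ccontr)
    assume "3 \<notin> tie_set n A r"
    then have coeffs: "tie_coeff r 3 = 0" "tie_coeff r 1 = 0" "tie_coeff r 0 = of_nat r"
      using not1 iff \<open>2 \<in> tie_set n A r\<close> by (simp_all add: tie_coeff_def)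
    have root: "poly (edge_poly n A r) x = 0"
      using edge_poly_root[OF p] by (simp add: r_def x_def)
    moreover have "x ^ n 2 = x ^ (n 2 - 1) * x"
      using n1 n12 by (metis gr_implies_not0 not_gr_zero power_minus_mult)
    ultimately have "(tie_coeff r 2 * x ^ (n 2 - 1) + of_nat r) * x = 0"
      by (simp add: poly_edge_poly coeffs algebra_simps)
    then have "tie_coeff r 2 * x ^ (n 2 - 1) = - of_nat r"
      using \<open>x \<noteq> 0\<close> by (simp add: eq_neg_iff_add_eq_0)
    then have "poly (pderiv (edge_poly n A r)) x = of_nat r - of_nat (n 2) * of_nat r"
      by (simp add: poly_pderiv_edge_poly coeffs mult.assoc)
    also have "\<dots> = of_int (int r - int (n 2) * int r)"
      by simp
    finally have deriv: "poly (pderiv (edge_poly n A r)) x = of_int (int r - int (n 2) * int r)" .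
    have "1 * int r < int (n 2) * int r"
      using n1 n12 \<open>r > 0\<close> by (intro mult_strict_right_mono) auto
    then have "int r - int (n 2) * int r < 0"
      by simp
    moreover have "ND2 n A r"
      using ND Gamma_cand_if_den_sol[OF p] by (simp add: r_def)
    ultimately show False
      using iff \<open>2 \<in> tie_set n A r\<close> \<open>x \<noteq> 0\<close> root deriv unfolding ND2_def by blast
  qed
  ultimately show ?thesis
    using not1 iff tie_set_subset[of r] unfolding r_def by blast
qed

section \<open>The bounds at the maximal degree\<close>

lemma card_nonconst_rat_sols: "card (nonconst_rat_sols n A) = card (den_sols n A)"
  unfolding nonconst_rat_sols_eq using inj_on_den_sols by (rule card_image)

text \<open>If 3 is tied at \<open>r\<close>, every solution has degree \<open>r\<close> and the
  least tied exponent decides the bound. For \<open>{2, 1}\<close> and \<open>{2, 1, 0}\<close> the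
  two layers are added.\<close>

lemma rat_sol_bounds:
  assumes "nonconst_rat_sols n A \<noteq> {}"
  shows "let r = Max (Gamma_sol n A); T = tie_set n A r; S = nonconst_rat_sols n A in
    finite S
    \<and> (C1 n A r \<longrightarrow> T = {3, 2, 0} \<and> card S \<le> n 3 - 1)
    \<and> (C2 n A r \<and> T = {2, 1} \<longrightarrow> card S \<le> n 3)
    \<and> (C2 n A r \<and> T = {3, 2, 1} \<longrightarrow> card S \<le> n 3 - n 1)
    \<and> (C3 n A r \<and> T = {2, 1, 0} \<longrightarrow> card S \<le> (n 2 - 1) + 2 * (n 3 - 1))
    \<and> (C3 n A r \<and> T = {3, 1, 0} \<longrightarrow> card S \<le> n 3 - 1)
    \<and> (C3 n A r \<and> T = {3, 2, 1, 0} \<longrightarrow> card S \<le> n 3 - 1)"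
proof -
  define r where "r = Max (Gamma_sol n A)"
  have fin: "finite (Gamma_sol n A)"
    unfolding Gamma_sol_eq using finite_den_sols by (rule finite_imageI)
  have "Gamma_sol n A \<noteq> {}"
    using assms unfolding Gamma_sol_eq nonconst_rat_sols_eq by simp
  then have "r \<in> Gamma_sol n A"
    unfolding r_def using fin by (intro Max_in)
  then obtain p where p: "p \<in> den_sols n A" and deg_p: "degree p = r"
    unfolding Gamma_sol_eq by blast
  have max: "degree q \<le> degree p" if "q \<in> den_sols n A" for q
    using Max_ge[OF fin, of "degree q"] that unfolding deg_p r_def Gamma_sol_eq by blast
  have slopes: "slope 3 = n 3" "slope 2 = n 2" "slope 1 = n 1" "slope 0 = 1"
    by (simp_all add: slope_def)
  have slope_ge_1: "1 \<le> slope l" if "l \<in> tie_set n A r" for l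
    using that n1 n12 n23 unfolding tie_set_iff by (auto simp: slope_def)
  have tied3: "card (den_sols n A) \<le> n 3 - 1" if "3 \<in> tie_set n A r"
    using card_den_sols_if_3_tied[OF p max, of 1] that slope_ge_1 by (simp add: deg_p)
  have tied321: "card (den_sols n A) \<le> n 3 - n 1" if "tie_set n A r = {3, 2, 1}"
  proof (rule card_den_sols_if_3_tied[OF p max])
    show "3 \<in> tie_set n A (degree p)"
      by (simp add: deg_p that)
    show "n 1 \<le> slope l" if "l \<in> tie_set n A (degree p)" for l
      using that \<open>tie_set n A r = {3, 2, 1}\<close> n12 n23 by (auto simp: deg_p slopes)
  qed
  have tied21: "card (den_sols n A) \<le> n 3" if "tie_set n A r = {2, 1}"
  proof -
    have "n 1 \<le> slope l \<and> slope l \<le> n 2" if "l \<in> tie_set n A (degree p)" for l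
      using that \<open>tie_set n A r = {2, 1}\<close> n12 by (auto simp: deg_p slopes)
    \<comment> \<open>The two layers together amount to \<open>n 3 - n 1\<close>.\<close>
    then have "card (den_sols n A) \<le> (n 2 - n 1) + (n 3 - n 2)"
      using card_den_sols_if_2_tied[OF p max] by (simp add: deg_p that)
    then show ?thesis
      using n12 n23 by linarith
  qed
  have tied210: "card (den_sols n A) \<le> (n 2 - 1) + 2 * (n 3 - 1)" if "tie_set n A r = {2, 1, 0}"
  proof -
    have "1 \<le> slope l \<and> slope l \<le> n 2" if "l \<in> tie_set n A (degree p)" for l
      using that \<open>tie_set n A r = {2, 1, 0}\<close> n1 n12 by (auto simp: deg_p slopes)
    \<comment> \<open>The two layers together amount to \<open>n 3 - 1\<close>.\<close>
    then have "card (den_sols n A) \<le> (n 2 - 1) + (n 3 - n 2)"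
      using card_den_sols_if_2_tied[OF p max] by (simp add: deg_p that)
    then show ?thesis
      using n1 n12 n23 by linarith
  qed
  have "finite (nonconst_rat_sols n A)"
    unfolding nonconst_rat_sols_eq using finite_den_sols by (rule finite_imageI)
  moreover have "C1 n A r \<Longrightarrow> tie_set n A r = {3, 2, 0}"
    using tie_set_if_C1[OF p] by (simp add: deg_p)
  ultimately show ?thesis
    unfolding Let_def card_nonconst_rat_sols r_def[symmetric]
    using tied3 tied321 tied21 tied210 by (intro conjI impI) auto
qed

end

section \<open>The bounds over the real and the complex numbers\<close>

theorem proposition6p3:
  fixes n :: "nat \<Rightarrow> nat"
  assumes "1 < n 1" and "n 1 < n 2" and "n 2 < n 3"
  shows "(\<forall>A :: nat \<Rightarrow> real poly.
           A 1 \<noteq> 0 \<and> A 2 \<noteq> 0 \<and> A 3 \<noteq> 0 \<and> ND_real n A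
           \<and> (\<exists>x \<in> nonconst_rat_sols n A. \<exists>y \<in> nonconst_rat_sols n A. x \<noteq> y)
           \<longrightarrow>
           (let r = Max (Gamma_sol n A); T = tie_set n A r; S = nonconst_rat_sols n A in
              finite S
              \<and> (C1 n A r \<longrightarrow> T = {3, 2, \<partial>} \<and> card S \<le> n 3 - 1)
              \<and> (C2 n A r \<and> T = {2, 1} \<longrightarrow> card S \<le> n 3)
              \<and> (C2 n A r \<and> T = {3, 2, 1} \<longrightarrow> card S \<le> n 3 - n 1)
              \<and> (C3 n A r \<and> T = {2, 1, \<partial>} \<longrightarrow> card S \<le> (n 2 - 1) + 2 * (n 3 - 1))
              \<and> (C3 n A r \<and> T = {3, 1, \<partial>} \<longrightarrow> card S \<le> n 3 - 1)
              \<and> (C3 n A r \<and> T = {3, 2, 1, \<partial>} \<longrightarrow> card S \<le> n 3 - 1)))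
       \<and> (\<forall>A :: nat \<Rightarrow> complex poly.
           A 1 \<noteq> 0 \<and> A 2 \<noteq> 0 \<and> A 3 \<noteq> 0 \<and> ND_complex n A
           \<and> (\<exists>x \<in> nonconst_rat_sols n A. \<exists>y \<in> nonconst_rat_sols n A. x \<noteq> y)
           \<longrightarrow>
           (let r = Max (Gamma_sol n A); T = tie_set n A r; S = nonconst_rat_sols n A in
              finite S
              \<and> (C1 n A r \<longrightarrow> T = {3, 2, \<partial>} \<and> card S \<le> n 3 - 1)
              \<and> (C2 n A r \<and> T = {2, 1} \<longrightarrow> card S \<le> n 3)
              \<and> (C2 n A r \<and> T = {3, 2, 1} \<longrightarrow> card S \<le> n 3 - n 1)
              \<and> (C3 n A r \<and> T = {2, 1, \<partial>} \<longrightarrow> card S \<le> (n 2 - 1) + 2 * (n 3 - 1))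
              \<and> (C3 n A r \<and> T = {3, 1, \<partial>} \<longrightarrow> card S \<le> n 3 - 1)
              \<and> (C3 n A r \<and> T = {3, 2, 1, \<partial>} \<longrightarrow> card S \<le> n 3 - 1)))"
proof (intro conjI allI impI; elim conjE)
  fix A :: "nat \<Rightarrow> real poly"
  assume A: "A 1 \<noteq> 0" "A 2 \<noteq> 0" "A 3 \<noteq> 0" "ND_real n A"
    and sols: "\<exists>x \<in> nonconst_rat_sols n A. \<exists>y \<in> nonconst_rat_sols n A. x \<noteq> y"
  interpret nondeg_power_ode n A
    using assms A by unfold_locales (auto simp: ND_real_def)
  show "let r = Max (Gamma_sol n A); T = tie_set n A r; S = nonconst_rat_sols n A in
      finite S
      \<and> (C1 n A r \<longrightarrow> T = {3, 2, \<partial>} \<and> card S \<le> n 3 - 1)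
      \<and> (C2 n A r \<and> T = {2, 1} \<longrightarrow> card S \<le> n 3)
      \<and> (C2 n A r \<and> T = {3, 2, 1} \<longrightarrow> card S \<le> n 3 - n 1)
      \<and> (C3 n A r \<and> T = {2, 1, \<partial>} \<longrightarrow> card S \<le> (n 2 - 1) + 2 * (n 3 - 1))
      \<and> (C3 n A r \<and> T = {3, 1, \<partial>} \<longrightarrow> card S \<le> n 3 - 1)
      \<and> (C3 n A r \<and> T = {3, 2, 1, \<partial>} \<longrightarrow> card S \<le> n 3 - 1)"
    by (rule rat_sol_bounds) (use sols in blast)
next
  fix A :: "nat \<Rightarrow> complex poly"
  assume A: "A 1 \<noteq> 0" "A 2 \<noteq> 0" "A 3 \<noteq> 0" "ND_complex n A"
    and sols: "\<exists>x \<in> nonconst_rat_sols n A. \<exists>y \<in> nonconst_rat_sols n A. x \<noteq> y"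
  interpret nondeg_power_ode n A
    using assms A by unfold_locales (auto simp: ND_complex_def)
  show "let r = Max (Gamma_sol n A); T = tie_set n A r; S = nonconst_rat_sols n A in
      finite S
      \<and> (C1 n A r \<longrightarrow> T = {3, 2, \<partial>} \<and> card S \<le> n 3 - 1)
      \<and> (C2 n A r \<and> T = {2, 1} \<longrightarrow> card S \<le> n 3)
      \<and> (C2 n A r \<and> T = {3, 2, 1} \<longrightarrow> card S \<le> n 3 - n 1)
      \<and> (C3 n A r \<and> T = {2, 1, \<partial>} \<longrightarrow> card S \<le> (n 2 - 1) + 2 * (n 3 - 1))
      \<and> (C3 n A r \<and> T = {3, 1, \<partial>} \<longrightarrow> card S \<le> n 3 - 1)
      \<and> (C3 n A r \<and> T = {3, 2, 1, \<partial>} \<longrightarrow> card S \<le> n 3 - 1)"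
    by (rule rat_sol_bounds) (use sols in blast)
qed

end
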